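(* Let $\mathbf{A}_1\in\mathbb{H}^{m\times n}_{r_1}$, $\mathbf{B}_2\in\mathbb{H}^{q\times s}_{r_2}$, $\mathbf{C}\in\mathbb{H}^{m\times s}$, and let $\mathbf{X}_1=\mathbf{A}_1^\dagger\mathbf{C}=(x^{(1)}_{ij})\in\mathbb{H}^{n\times s}$ and $\mathbf{X}_2=\mathbf{C}\mathbf{B}_2^\dagger-\mathbf{Q}_{A_1}\mathbf{C}\mathbf{B}_2^\dagger=(x^{(2)}_{gf})\in\mathbb{H}^{m\times q}$. Let $\mathbf{c}^{(1)}_{.j}$ be the $j$th column of $\mathbf{C}_1=\mathbf{A}_1^*\mathbf{C}$, $\mathbf{c}^{(2)}_{g.}$ the $g$th row of $\mathbf{C}_2=\mathbf{C}\mathbf{B}_2^*$, and $\ddot{\mathbf{a}}^{(1)}_{g.}$ the $g$th row of $\mathbf{A}_1\mathbf{A}_1^*$. Then $$x^{(1)}_{ij}=\frac{\sum_{\beta\in J_{r_1,n}\{i\}}\mathrm{cdet}_i\big((\mathbf{A}_1^*\mathbf{A}_1)_{.i}(\mathbf{c}^{(1)}_{.j})\big)^\beta_\beta}{\sum_{\beta\in J_{r_1,n}}|\mathbf{A}_1^*\mathbf{A}_1|^\beta_\beta},$$ $$x^{(2)}_{gf}=\frac{\sum_{\alpha\in I_{r_2,q}\{f\}}\mathrm{rdet}_f\big((\mathbf{B}_2\mathbf{B}_2^* )_{f.}(\mathbf{c}^{(2)}_{g.})\big)^\alpha_\alpha}{\sum_{\alpha\in I_{r_2,q}}|\mathbf{B}_2\mathbf{B}_2^*|^\alpha_\alpha}-\frac{\sum_{l=1}^m\sum_{\alpha\in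 I_{r_1,m}\{l\}}\mathrm{rdet}_l\big((\mathbf{A}_1\mathbf{A}_1^* )_{l.}(\ddot{\mathbf{a}}^{(1)}_{g.})\big)^\alpha_\alpha\sum_{\alpha\in I_{r_2,q}\{f\}}\mathrm{rdet}_f\big((\mathbf{B}_2\mathbf{B}_2^* )_{f.}(\mathbf{c}^{(2)}_{l.})\big)^\alpha_\alpha}{\sum_{\alpha\in I_{r_1,m}}|\mathbf{A}_1\mathbf{A}_1^*|^\alpha_\alpha\sum_{\alpha\in I_{r_2,q}}|\mathbf{B}_2\mathbf{B}_2^*|^\alpha_\alpha}.$$
   Context: $\mathbb{H}$ is the skew field of real quaternions; $\mathbb{H}^{m\times n}$ is the set of $m\times n$ matrices over $\mathbb{H}$ and $\mathbb{H}^{m\times n}_r$ the subset of those of rank $r$. $\mathbf{A}^*$ is the conjugate transpose and $\mathbf{A}^\dagger$ the Moore–Penrose inverse (the unique $\mathbf{X}$ with $\mathbf{AXA}=\mathbf{A}$, $\mathbf{XAX}=\mathbf{X}$, $(\mathbf{AX})^*=\mathbf{AX}$, $(\mathbf{XA})^*=\mathbf{XA}$). $\mathbf{Q}_A=\mathbf{A}\mathbf{A}^\dagger$. For a matrix $\mathbf{F}$, $\mathbf{F}_{.j}(\mathbf{b})$ (resp. $\mathbf{F}_{i.}(\mathbf{b})$) is $\mathbf{F}$ with its $j$th column (resp. $i$th row) replaced by the column (resp. row) $\mathbf{b}$. Row/column determinants: for $\mathbf{F}=(a_{ij})\in\mathbb{H}^{n\times n}$, $\mathrm{rdet}_i\mathbf{F}=\sum_{\sigma\in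 S_n}(-1)^{n-r}(a_{i\,i_{k_1}}a_{i_{k_1}i_{k_1+1}}\cdots a_{i_{k_1+l_1}i})\cdots(a_{i_{k_r}i_{k_r+1}}\cdots a_{i_{k_r+l_r}i_{k_r}})$, where $\sigma=(i\,i_{k_1}\,i_{k_1+1}\cdots i_{k_1+l_1})(i_{k_2}\cdots i_{k_2+l_2})\cdots(i_{k_r}\cdots i_{k_r+l_r})$ is the decomposition of $\sigma$ into $r$ disjoint cycles (fixed points included) with $i_{k_2}<\cdots<i_{k_r}$ and $i_{k_t}<i_{k_t+s}$ for $t=2,\dots,r$, $s=1,\dots,l_t$; and $\mathrm{cdet}_j\mathbf{F}=\sum_{\tau\in S_n}(-1)^{n-r}(a_{j_{k_r}j_{k_r+l_r}}\cdots a_{j_{k_r+1}j_{k_r}})\cdots(a_{j\,j_{k_1+l_1}}\cdots a_{j_{k_1+1}j_{k_1}}a_{j_{k_1}j})$, where $\tau=(j_{k_r+l_r}\cdots j_{k_r+1}\,j_{k_r})\cdots(j_{k_2+l_2}\cdots j_{k_2})(j_{k_1+l_1}\cdots j_{k_1+1}\,j_{k_1}\,j)$ is the decomposition into $r$ disjoint cycles with $j_{k_2}<\cdots<j_{k_r}$ and $j_{k_t}<j_{k_t+s}$ for $t=2,\dots,r$, $s=1,\dots,l_t$. For Hermitian $\mathbf{F}$ all these coincide and are real; this value is $\det\mathbf{F}$. Index sets: $L_{k,n}$ is the set of strictly increasing sequences $\alpha=(\alpha_1<\cdots<\alpha_k)$ in $\{1,\dots,n\}$; $I_{k,m}\{i\}=\{\alpha\in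 L_{k,m}: i\in\alpha\}$, $J_{k,n}\{j\}=\{\beta\in L_{k,n}: j\in\beta\}$; sums over $J_{k,n}$ or $I_{k,m}$ without braces run over all of $L_{k,n}$, $L_{k,m}$. For a square $\mathbf{F}$, $\mathbf{F}^\alpha_\alpha$ is the principal submatrix with rows and columns indexed by $\alpha$; $\mathrm{cdet}_i(\mathbf{G})^\beta_\beta$ (resp. $\mathrm{rdet}_j(\mathbf{G})^\alpha_\alpha$) is the column (resp. row) determinant of the principal submatrix $\mathbf{G}^\beta_\beta$ taken at the column (resp. row) coming from index $i$ (resp. $j$); for Hermitian $\mathbf{F}$, $|\mathbf{F}|^\alpha_\alpha=\det\mathbf{F}^\alpha_\alpha$. *)

theory Defs
  imports Complex_Main "Jordan_Normal_Form.Matrix" "HOL-Combinatorics.Permutations"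
begin

datatype quat = Quat (qre: real) (qi: real) (qj: real) (qk: real)

lemma quat_eq_iff: "x = y \<longleftrightarrow> qre x = qre y \<and> qi x = qi y \<and> qj x = qj y \<and> qk x = qk y"
  by (cases x; cases y) auto

instantiation quat :: division_ring
begin

definition "0 = Quat 0 0 0 0"
definition "1 = Quat 1 0 0 0"
definition "x + y = Quat (qre x + qre y) (qi x + qi y) (qj x + qj y) (qk x + qk y)"
definition "x - y = Quat (qre x - qre y) (qi x - qi y) (qj x - qj y) (qk x - qk y)"
definition "- x = Quat (- qre x) (- qi x) (- qj x) (- qk x)"
definition "x * y = Quat
   (qre x * qre y - qi x * qi y - qj x * qj y - qk x * qk y)
   (qre x * qi y + qi x * qre y + qj x * qk y - qk x * qj y)
   (qre x * qj y - qi x * qk y + qj x * qre y + qk x * qi y)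
   (qre x * qk y + qi x * qj y - qj x * qi y + qk x * qre y)"
definition "inverse x = (let d = (qre x)\<^sup>2 + (qi x)\<^sup>2 + (qj x)\<^sup>2 + (qk x)\<^sup>2 in
   Quat (qre x / d) (- qi x / d) (- qj x / d) (- qk x / d))"
definition "x div (y::quat) = x * inverse y"

lemma sumsq_nz: "x \<noteq> (0::quat) \<Longrightarrow> (qre x)\<^sup>2 + (qi x)\<^sup>2 + (qj x)\<^sup>2 + (qk x)\<^sup>2 \<noteq> 0"
  by (cases x) (auto simp: zero_quat_def add_nonneg_eq_0_iff)

instance
proof
  fix a b c :: quat
  show "a * b * c = a * (b * c)" by (simp add: times_quat_def quat_eq_iff algebra_simps)
  show "(a + b) * c = a * c + b * c" by (simp add: times_quat_def plus_quat_def quat_eq_iff algebra_simps)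
  show "a * (b + c) = a * b + a * c" by (simp add: times_quat_def plus_quat_def quat_eq_iff algebra_simps)
  show "a + b + c = a + (b + c)" by (simp add: plus_quat_def)
  show "a + b = b + a" by (simp add: plus_quat_def)
  show "0 + a = a" by (simp add: plus_quat_def zero_quat_def)
  show "- a + a = 0" by (simp add: plus_quat_def zero_quat_def uminus_quat_def)
  show "a - b = a + - b" by (simp add: plus_quat_def minus_quat_def uminus_quat_def)
  show "1 * a = a" by (simp add: times_quat_def one_quat_def)
  show "a * 1 = a" by (simp add: times_quat_def one_quat_def)
  show "(0::quat) \<noteq> 1" by (simp add: zero_quat_def one_quat_def)
  show "divide a b = a * inverse b" by (simp add: divide_quat_def)
  show "inverse (0::quat) = 0" by (simp add: inverse_quat_def zero_quat_def)
  assume a: "a \<noteq> 0"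
  define d where "d = (qre a)\<^sup>2 + (qi a)\<^sup>2 + (qj a)\<^sup>2 + (qk a)\<^sup>2"
  have d: "d \<noteq> 0" using a unfolding d_def by (rule sumsq_nz)
  have inv: "inverse a = Quat (qre a / d) (- qi a / d) (- qj a / d) (- qk a / d)"
    by (simp add: inverse_quat_def d_def Let_def)
  have dd: "qre a * qre a + qi a * qi a + qj a * qj a + qk a * qk a = d"
    by (simp add: d_def power2_eq_square)
  show "inverse a * a = 1" unfolding inv using d dd
    by (simp add: times_quat_def one_quat_def quat_eq_iff field_simps)
  show "a * inverse a = 1" unfolding inv using d dd
    by (simp add: times_quat_def one_quat_def quat_eq_iff field_simps)
qed
end

definition qcnj :: "quat \<Rightarrow> quat" where
  "qcnj x = Quat (qre x) (- qi x) (- qj x) (- qk x)"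


definition qadj :: "quat mat \<Rightarrow> quat mat" where
  "qadj A = mat (dim_col A) (dim_row A) (\<lambda>(i, j). qcnj (A $$ (j, i)))"

text \<open>Columns indexed by J are right linearly independent (scalars act on the right,
  as for the column space {A x}).\<close>
definition right_indep_cols :: "quat mat \<Rightarrow> nat set \<Rightarrow> bool" where
  "right_indep_cols A J \<longleftrightarrow>
     (\<forall>c :: nat \<Rightarrow> quat. (\<forall>i < dim_row A. (\<Sum>j\<in>J. A $$ (i, j) * c j) = 0) \<longrightarrow> (\<forall>j\<in>J. c j = 0))"

definition qrank :: "quat mat \<Rightarrow> nat" where
  "qrank A = Max {k. \<exists>J. J \<subseteq> {0..<dim_col A} \<and> card J = k \<and> right_indep_cols A J}"

definition mp_inv :: "quat mat \<Rightarrow> quat mat" where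
  "mp_inv A = (THE X. X \<in> carrier_mat (dim_col A) (dim_row A) \<and>
      A * X * A = A \<and> X * A * X = X \<and> qadj (A * X) = A * X \<and> qadj (X * A) = X * A)"

definition col_repl :: "quat mat \<Rightarrow> nat \<Rightarrow> quat vec \<Rightarrow> quat mat" where
  "col_repl F j b = mat (dim_row F) (dim_col F) (\<lambda>(i, k). if k = j then b $ i else F $$ (i, k))"

definition row_repl :: "quat mat \<Rightarrow> nat \<Rightarrow> quat vec \<Rightarrow> quat mat" where
  "row_repl F i b = mat (dim_row F) (dim_col F) (\<lambda>(k, l). if k = i then b $ l else F $$ (k, l))"

definition cyc_len :: "(nat \<Rightarrow> nat) \<Rightarrow> nat \<Rightarrow> nat" where
  "cyc_len p x = (LEAST k. 0 < k \<and> (p ^^ k) x = x)"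

definition cyc_list :: "(nat \<Rightarrow> nat) \<Rightarrow> nat \<Rightarrow> nat list" where
  "cyc_list p x = map (\<lambda>k. (p ^^ k) x) [0..<cyc_len p x]"

definition cyc_prod :: "quat mat \<Rightarrow> (nat \<Rightarrow> nat) \<Rightarrow> nat \<Rightarrow> quat" where
  "cyc_prod F p x = (let c = cyc_list p x; l = length c in
      prod_list (map (\<lambda>k. F $$ (c ! k, c ! ((k + 1) mod l))) [0..<l]))"

definition cyc_leaders :: "(nat \<Rightarrow> nat) \<Rightarrow> nat set \<Rightarrow> nat set" where
  "cyc_leaders p S = {x \<in> S. x = Min (set (cyc_list p x))}"

definition psign :: "nat set \<Rightarrow> (nat \<Rightarrow> nat) \<Rightarrow> quat" where
  "psign S p = (- 1) ^ (card S - card (cyc_leaders p S))"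

text \<open>rdet_i of the principal submatrix F^S_S (i in S): cycle of i first, then
  the other cycles by increasing leader.\<close>
definition rdet :: "nat set \<Rightarrow> nat \<Rightarrow> quat mat \<Rightarrow> quat" where
  "rdet S i F = (\<Sum>p\<in>{p. p permutes S}. psign S p *
      (cyc_prod F p i *
       prod_list (map (cyc_prod F p) (sorted_list_of_set (cyc_leaders p S - set (cyc_list p i))))))"

text \<open>cdet_j of the principal submatrix F^S_S (j in S): other cycles by decreasing
  leader, then the cycle of j last.\<close>
definition cdet :: "nat set \<Rightarrow> nat \<Rightarrow> quat mat \<Rightarrow> quat" where
  "cdet S j F = (\<Sum>p\<in>{p. p permutes S}. psign S p *
      (prod_list (map (cyc_prod F p) (rev (sorted_list_of_set (cyc_leaders p S - set (cyc_list p j))))) *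
       cyc_prod F p j))"

text \<open>|F|^S_S: the determinant of a Hermitian principal submatrix (the common value of
  all its row/column determinants); here realised as the row determinant with all cycles
  ordered by increasing leader, which equals rdet at Min S (and is 1 for S empty).\<close>
definition hdet :: "nat set \<Rightarrow> quat mat \<Rightarrow> quat" where
  "hdet S F = (\<Sum>p\<in>{p. p permutes S}. psign S p *
      prod_list (map (cyc_prod F p) (sorted_list_of_set (cyc_leaders p S))))"

definition Lset :: "nat \<Rightarrow> nat \<Rightarrow> nat set set" where
  "Lset k n = {\<beta>. \<beta> \<subseteq> {0..<n} \<and> card \<beta> = k}"

end

theory Submission
  imports Defs "HOL-Combinatorics.Cycles"
begin

text \<open>Let \<open>F = A\<^sup>* A\<close>. For every index set \<open>S\<close>, peeling off the first factor of the cycle through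
  \<open>i\<close> writes \<open>cdet S i\<close> of \<open>F\<close> with column \<open>i\<close> replaced by \<open>b\<close> as \<open>\<Sum>j\<in>S. N\<^sub>S i j * b j\<close>, where
  \<open>N\<^sub>S\<close> is Hermitian and \<open>F\<^sub>S N\<^sub>S = N\<^sub>S F\<^sub>S = d\<^sub>S I\<close> with \<open>d\<^sub>S\<close> the real principal minor. Summing over all
  \<open>S\<close> with \<open>k\<close> elements gives matrices \<open>N\<^sub>k\<close> and reals \<open>d\<^sub>k\<close> with \<open>F N\<^sub>k + N\<^sub>k\<^sub>+\<^sub>1 = d\<^sub>k I\<close>. The minor \<open>d\<^sub>S\<close> is
  positive if the columns of \<open>A\<close> in \<open>S\<close> are independent and zero otherwise, so with \<open>r\<close> the rank of \<open>A\<close>,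
  \<open>d\<^sub>r\<close> is nonzero and \<open>d\<^sub>k = 0\<close> for \<open>k > r\<close>. Descending from \<open>k > n\<close> yields \<open>N\<^sub>k A\<^sup>* = 0\<close> for \<open>k > r\<close>;
  hence \<open>F N\<^sub>r A\<^sup>* = d\<^sub>r A\<^sup>*\<close>, and \<open>N\<^sub>r A\<^sup>* / d\<^sub>r\<close> satisfies the Penrose equations. The row formulas
  follow by conjugate transposition, and \<open>Q\<^sub>A\<close> is the row formula for \<open>C = A\<close>.\<close>

subsection \<open>Quaternions\<close>

lemma quat_sel_simps [simp]:
  "qre 0 = 0" "qi 0 = 0" "qj 0 = 0" "qk 0 = 0"
  "qre 1 = 1" "qi 1 = 0" "qj 1 = 0" "qk 1 = 0"
  "qre (x + y) = qre x + qre y" "qi (x + y) = qi x + qi y"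
  "qj (x + y) = qj x + qj y" "qk (x + y) = qk x + qk y"
  "qre (x - y) = qre x - qre y" "qi (x - y) = qi x - qi y"
  "qj (x - y) = qj x - qj y" "qk (x - y) = qk x - qk y"
  "qre (- x) = - qre x" "qi (- x) = - qi x" "qj (- x) = - qj x" "qk (- x) = - qk x"
  "qre (qcnj x) = qre x" "qi (qcnj x) = - qi x" "qj (qcnj x) = - qj x" "qk (qcnj x) = - qk x"
  by (simp_all add: zero_quat_def one_quat_def plus_quat_def minus_quat_def uminus_quat_def qcnj_def)

lemma quat_times_sel:
  "qre (x * y) = qre x * qre y - qi x * qi y - qj x * qj y - qk x * qk y"
  "qi (x * y) = qre x * qi y + qi x * qre y + qj x * qk y - qk x * qj y"
  "qj (x * y) = qre x * qj y - qi x * qk y + qj x * qre y + qk x * qi y"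
  "qk (x * y) = qre x * qk y + qi x * qj y - qj x * qi y + qk x * qre y"
  by (simp_all add: times_quat_def)

lemma qcnj_simps [simp]:
  "qcnj 0 = 0" "qcnj 1 = 1" "qcnj (x + y) = qcnj x + qcnj y" "qcnj (x - y) = qcnj x - qcnj y"
  "qcnj (- x) = - qcnj x" "qcnj (x * y) = qcnj y * qcnj x" "qcnj (qcnj x) = x"
  by (simp_all add: quat_eq_iff quat_times_sel algebra_simps)

lemma qcnj_sum: "qcnj (sum f A) = (\<Sum>x\<in>A. qcnj (f x))"
  by (induction A rule: infinite_finite_induct) auto

lemma qre_sum: "qre (sum f A) = (\<Sum>x\<in>A. qre (f x))"
  by (induction A rule: infinite_finite_induct) auto

definition qreal :: "quat \<Rightarrow> bool" where
  "qreal x \<longleftrightarrow> qcnj x = x"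

lemma qreal_iff: "qreal x \<longleftrightarrow> qi x = 0 \<and> qj x = 0 \<and> qk x = 0"
  by (auto simp: qreal_def quat_eq_iff)

text \<open>Real quaternions are central. Minors can be moved past entries and weights only because
  they turn out to be real.\<close>

lemma qreal_commute: "qreal x \<Longrightarrow> x * y = y * x"
  by (simp add: qreal_iff quat_eq_iff quat_times_sel)

lemma qreal_sum: "(\<And>x. x \<in> A \<Longrightarrow> qreal (f x)) \<Longrightarrow> qreal (sum f A)"
  by (simp add: qreal_def qcnj_sum)

lemma qreal_inverse: "qreal x \<Longrightarrow> qreal (inverse x)"
  by (simp add: qreal_iff inverse_quat_def Let_def)

lemma qre_qcnj_mult_nonneg: "qre (qcnj x * x) \<ge> 0"
  by (simp add: quat_times_sel)

lemma qre_qcnj_mult_eq_0_iff: "qre (qcnj x * x) = 0 \<longleftrightarrow> x = 0"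
proof -
  have "qre (qcnj x * x) = (qre x)\<^sup>2 + (qi x)\<^sup>2 + (qj x)\<^sup>2 + (qk x)\<^sup>2"
    by (simp add: quat_times_sel power2_eq_square)
  then show ?thesis using sumsq_nz[of x] by auto
qed

text \<open>Quaternions carry no topology here, so continuity is taken componentwise.\<close>
definition qcont0 :: "(real \<Rightarrow> quat) \<Rightarrow> bool" where
  "qcont0 g \<longleftrightarrow> isCont (\<lambda>t. qre (g t)) 0 \<and> isCont (\<lambda>t. qi (g t)) 0
     \<and> isCont (\<lambda>t. qj (g t)) 0 \<and> isCont (\<lambda>t. qk (g t)) 0"

lemma qcont0_const [simp]: "qcont0 (\<lambda>t. c)"
  by (simp add: qcont0_def)

lemma qcont0_real [simp]: "qcont0 (\<lambda>t. Quat t 0 0 0)"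
  by (simp add: qcont0_def)

lemma qcont0_uminus: "qcont0 g \<Longrightarrow> qcont0 (\<lambda>t. - g t)"
  by (simp add: qcont0_def)

lemma qcont0_mult: "qcont0 g \<Longrightarrow> qcont0 h \<Longrightarrow> qcont0 (\<lambda>t. g t * h t)"
  by (auto simp: qcont0_def quat_times_sel intro!: continuous_intros)

lemma qcont0_sum: "(\<And>x. x \<in> A \<Longrightarrow> qcont0 (g x)) \<Longrightarrow> qcont0 (\<lambda>t. \<Sum>x\<in>A. g x t)"
proof (induction A rule: infinite_finite_induct)
  case (insert a A)
  then have "qcont0 (g a)" "qcont0 (\<lambda>t. \<Sum>x\<in>A. g x t)" by auto
  with insert show ?case by (auto simp: qcont0_def intro!: continuous_intros)
qed auto

text \<open>A limit at 0 ignores the value at 0, so two functions continuous there and equal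
  elsewhere share it. This carries an identity from perturbed matrices to the original one.\<close>

lemma qcont0_eq_at_0:
  assumes "qcont0 g" "qcont0 h" and eq: "\<And>t. t \<noteq> 0 \<Longrightarrow> g t = h t"
  shows "g 0 = h 0"
proof -
  have *: "a 0 = b 0" if "isCont a 0" "isCont b 0" "\<And>t. t \<noteq> 0 \<Longrightarrow> a t = b t" for a b :: "real \<Rightarrow> real"
  proof -
    have "a \<midarrow>0\<rightarrow> a 0" "b \<midarrow>0\<rightarrow> b 0" using that by (auto simp: isCont_def)
    moreover have "a \<midarrow>0\<rightarrow> L \<longleftrightarrow> b \<midarrow>0\<rightarrow> L" for L
      by (rule LIM_equal) (use that(3) in auto)
    ultimately show ?thesis using LIM_unique by blast
  qed
  have "\<And>t. t \<noteq> 0 \<Longrightarrow> qre (g t) = qre (h t)" "\<And>t. t \<noteq> 0 \<Longrightarrow> qi (g t) = qi (h t)"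
    "\<And>t. t \<noteq> 0 \<Longrightarrow> qj (g t) = qj (h t)" "\<And>t. t \<noteq> 0 \<Longrightarrow> qk (g t) = qk (h t)"
    using eq by auto
  with assms(1,2) show ?thesis unfolding qcont0_def quat_eq_iff
    by (intro conjI *[of "\<lambda>t. qre (g t)" "\<lambda>t. qre (h t)"] *[of "\<lambda>t. qi (g t)" "\<lambda>t. qi (h t)"]
       *[of "\<lambda>t. qj (g t)" "\<lambda>t. qj (h t)"] *[of "\<lambda>t. qk (g t)" "\<lambda>t. qk (h t)"]) auto
qed

text \<open>Serves the termination proof of the mutual recursion below, whose calls drop an element
  from the index set.\<close>

lemma card_pred_less_iff: "finite T \<Longrightarrow> card T - Suc 0 < card T \<longleftrightarrow> T \<noteq> {}"
  by (cases "card T") auto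

subsection \<open>Principal minors and adjugates of Hermitian matrices\<close>

text \<open>Determinant and adjugate of the principal submatrix of \<open>f\<close> on \<open>T\<close>, for Hermitian \<open>f\<close>. The
  determinant is expanded along its least index, the leader of the first cycle.\<close>
function pdet :: "(nat \<Rightarrow> nat \<Rightarrow> quat) \<Rightarrow> nat set \<Rightarrow> quat"
  and padj :: "(nat \<Rightarrow> nat \<Rightarrow> quat) \<Rightarrow> nat set \<Rightarrow> nat \<Rightarrow> nat \<Rightarrow> quat" where
  "pdet f T = (if finite T \<and> T \<noteq> {} then
      pdet f (T - {Min T}) * f (Min T) (Min T)
      - (\<Sum>l\<in>T - {Min T}. \<Sum>j\<in>T - {Min T}. f (Min T) j * padj f (T - {Min T}) j l * f l (Min T))
    else 1)"
| "padj f T i j = (if finite T \<and> i \<in> T \<and> j \<in> T then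
      if i = j then pdet f (T - {i}) else - (\<Sum>l\<in>T - {i}. f i l * padj f (T - {i}) l j)
    else 0)"
  by pat_completeness auto
termination
  by (relation "measure (\<lambda>x. case x of Inl (f, T) \<Rightarrow> card T | Inr (f, T, i, j) \<Rightarrow> card T)")
    (auto simp: card_pred_less_iff)

declare pdet.simps [simp del] padj.simps [simp del]

lemma pdet_empty [simp]: "pdet f {} = 1"
  by (simp add: pdet.simps)

lemma padj_same: "finite T \<Longrightarrow> i \<in> T \<Longrightarrow> padj f T i i = pdet f (T - {i})"
  by (simp add: padj.simps)

lemma padj_neq: "finite T \<Longrightarrow> i \<in> T \<Longrightarrow> j \<in> T \<Longrightarrow> i \<noteq> j \<Longrightarrow>
    padj f T i j = - (\<Sum>l\<in>T - {i}. f i l * padj f (T - {i}) l j)"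
  by (subst padj.simps) simp

lemma padj_outside: "i \<notin> T \<or> j \<notin> T \<Longrightarrow> padj f T i j = 0"
  by (auto simp: padj.simps)

text \<open>A diagonal entry of the adjugate times the matrix, that is, the expansion of the minor
  along \<open>i\<close>. That it does not depend on \<open>i\<close> is the hard part of Cramer's
  rule here.\<close>

definition pdiag :: "(nat \<Rightarrow> nat \<Rightarrow> quat) \<Rightarrow> nat set \<Rightarrow> nat \<Rightarrow> quat" where
  "pdiag f T i = (\<Sum>l\<in>T. padj f T i l * f l i)"

lemma padj_mult_expand:
  assumes "finite T" "i \<in> T"
  shows "(\<Sum>l\<in>T. padj f T i l * f l j) = pdet f (T - {i}) * f i j
      - (\<Sum>l\<in>T - {i}. \<Sum>k\<in>T - {i}. f i k * padj f (T - {i}) k l * f l j)"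
proof -
  have "(\<Sum>l\<in>T. padj f T i l * f l j) = padj f T i i * f i j + (\<Sum>l\<in>T - {i}. padj f T i l * f l j)"
    using assms by (simp add: sum.remove)
  also have "(\<Sum>l\<in>T - {i}. padj f T i l * f l j)
      = (\<Sum>l\<in>T - {i}. - (\<Sum>k\<in>T - {i}. f i k * padj f (T - {i}) k l * f l j))"
    using assms by (intro sum.cong) (auto simp: padj_neq sum_distrib_right)
  finally show ?thesis using assms by (simp add: padj_same sum_negf)
qed

lemma pdet_eq_pdiag: "finite T \<Longrightarrow> T \<noteq> {} \<Longrightarrow> pdet f T = pdiag f T (Min T)"
  unfolding pdiag_def by (subst pdet.simps, subst padj_mult_expand) (auto simp: Min_in)

definition herm :: "(nat \<Rightarrow> nat \<Rightarrow> quat) \<Rightarrow> bool" where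
  "herm f \<longleftrightarrow> (\<forall>i j. qcnj (f i j) = f j i)"

lemma hermD: "herm f \<Longrightarrow> qcnj (f i j) = f j i"
  by (simp add: herm_def)

text \<open>Invariant for the induction over index sets. Only the left product is recorded; the
  right one follows by conjugation.\<close>

definition cramer :: "(nat \<Rightarrow> nat \<Rightarrow> quat) \<Rightarrow> nat set \<Rightarrow> bool" where
  "cramer f T \<longleftrightarrow> qreal (pdet f T) \<and> (\<forall>i j. qcnj (padj f T i j) = padj f T j i) \<and>
     (\<forall>i\<in>T. \<forall>j\<in>T. (\<Sum>l\<in>T. padj f T i l * f l j) = (if i = j then pdet f T else 0))"

lemma cramer_right:
  assumes "cramer f T" "herm f" "i \<in> T" "j \<in> T"
  shows "(\<Sum>l\<in>T. f i l * padj f T l j) = (if i = j then pdet f T else 0)"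
proof -
  have "qcnj (padj f T a b) = padj f T b a" for a b
    using assms by (simp add: cramer_def)
  then have "(\<Sum>l\<in>T. f i l * padj f T l j) = qcnj (\<Sum>l\<in>T. padj f T j l * f l i)"
    using assms by (simp add: qcnj_sum hermD)
  also have "\<dots> = qcnj (if j = i then pdet f T else 0)"
    using assms by (simp add: cramer_def)
  also have "\<dots> = (if i = j then pdet f T else 0)"
    using assms by (auto simp: cramer_def qreal_def)
  finally show ?thesis .
qed

text \<open>By the recursion both are polynomial in the entries: finitely many sums and
  products.\<close>

lemma qcont0_pdet_padj:
  assumes "\<And>i j. qcont0 (\<lambda>t. g t i j)"
  shows "qcont0 (\<lambda>t. pdet (g t) T)" "qcont0 (\<lambda>t. padj (g t) T i j)"
proof -
  have "qcont0 (\<lambda>t. pdet (g t) T) \<and> (\<forall>i j. qcont0 (\<lambda>t. padj (g t) T i j))"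
  proof (cases "finite T")
    case True
    then show ?thesis
    proof (induction T rule: finite_psubset_induct)
      case (psubset T)
      have IH: "qcont0 (\<lambda>t. pdet (g t) (T - {i}))" "qcont0 (\<lambda>t. padj (g t) (T - {i}) j k)" if "i \<in> T" for i j k
        using psubset.IH[of "T - {i}"] that by auto
      have padj: "qcont0 (\<lambda>t. padj (g t) T i j)" for i j
      proof (cases "i \<in> T \<and> j \<in> T")
        case True
        then show ?thesis
          by (cases "i = j") (auto simp: psubset.hyps padj_same padj_neq
              intro!: qcont0_uminus qcont0_sum qcont0_mult assms IH)
      qed (simp add: padj_outside)
      have "qcont0 (\<lambda>t. pdet (g t) T)"
      proof (cases "T = {}")
        case False
        then show ?thesis using psubset.hyps
          by (auto simp: pdet_eq_pdiag pdiag_def intro!: qcont0_sum qcont0_mult assms padj)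
      qed simp
      with padj show ?case by blast
    qed
  next
    case False
    \<comment> \<open>On infinite sets both functions have constant default values.\<close>
    then show ?thesis by (simp add: pdet.simps padj.simps)
  qed
  then show "qcont0 (\<lambda>t. pdet (g t) T)" "qcont0 (\<lambda>t. padj (g t) T i j)" by blast+
qed

text \<open>The inductive step as a context. The hypothesis ranges over all Hermitian matrices,
  because the equality of the diagonal entries passes through perturbed matrices.\<close>

locale cramer_step =
  fixes T :: "nat set"
  assumes fin: "finite T" and IH: "\<And>S f. S \<subset> T \<Longrightarrow> herm f \<Longrightarrow> cramer f S"
begin

lemma IH1: "herm f \<Longrightarrow> i \<in> T \<Longrightarrow> cramer f (T - {i})"
  by (intro IH) auto

text \<open>Two unfoldings write the entry through the adjugate of \<open>T - {i, j}\<close>, in a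
  form that conjugation turns into the same form with \<open>i\<close> and \<open>j\<close>
  exchanged.\<close>

lemma padj_herm:
  assumes f: "herm f"
  shows "qcnj (padj f T i j) = padj f T j i"
proof -
  consider "i \<notin> T \<or> j \<notin> T" | "i \<in> T" "i = j" | "i \<in> T" "j \<in> T" "i \<noteq> j" by blast
  then show ?thesis
  proof cases
    case 1 then show ?thesis by (auto simp: padj_outside)
  next
    case 2 then show ?thesis using IH1[OF f, of i] fin by (simp add: padj_same cramer_def qreal_def)
  next
    case 3
    have two: "padj f T a b = - (f a b * pdet f (T - {a,b}))
        + (\<Sum>l\<in>T - {a,b}. \<Sum>k\<in>T - {a,b}. f a l * padj f (T - {a,b}) l k * f k b)"
      if ab: "a \<in> T" "b \<in> T" "a \<noteq> b" for a b
    proof -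
      let ?U = "T - {a,b}"
      have U: "T - {a} - {b} = ?U" by auto
      have cU: "cramer f ?U" using f ab by (intro IH) auto
      have "padj f (T - {a}) l b = - (\<Sum>k\<in>?U. padj f ?U l k * f k b)" if l: "l \<in> ?U" for l
      proof -
        \<comment> \<open>Direct unfolding would remove the varying index \<open>l\<close>; after
          conjugation the fixed index \<open>b\<close> is removed, leaving one common set.\<close>
        have "padj f (T - {a}) l b = qcnj (padj f (T - {a}) b l)"
          using IH1[OF f, of a] ab by (simp add: cramer_def)
        also have "padj f (T - {a}) b l = - (\<Sum>k\<in>?U. f b k * padj f ?U k l)"
          using ab l fin by (subst padj_neq) (auto simp: U)
        also have "qcnj \<dots> = - (\<Sum>k\<in>?U. padj f ?U l k * f k b)"
          using cU f by (simp add: qcnj_sum cramer_def hermD)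
        finally show ?thesis .
      qed
      then have "(\<Sum>l\<in>?U. f a l * padj f (T - {a}) l b) = - (\<Sum>l\<in>?U. \<Sum>k\<in>?U. f a l * padj f ?U l k * f k b)"
        by (simp add: sum_distrib_left sum_negf mult.assoc)
      moreover have "(\<Sum>l\<in>T - {a}. f a l * padj f (T - {a}) l b)
          = f a b * pdet f ?U + (\<Sum>l\<in>?U. f a l * padj f (T - {a}) l b)"
        using ab fin by (subst sum.remove[of _ b]) (auto simp: padj_same U)
      ultimately show ?thesis using ab fin by (subst padj_neq) auto
    qed
    let ?U = "T - {i,j}"
    have U: "T - {j,i} = ?U" by auto
    have cU: "cramer f ?U" using f 3 by (intro IH) auto
    have "qcnj (padj f T i j) = - (pdet f ?U * f j i)
        + (\<Sum>l\<in>?U. \<Sum>k\<in>?U. f j k * (padj f ?U k l * f l i))"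
      using 3 f cU by (simp add: two qcnj_sum hermD cramer_def qreal_def)
    also have "\<dots> = - (f j i * pdet f ?U)
        + (\<Sum>l\<in>?U. \<Sum>k\<in>?U. f j l * padj f ?U l k * f k i)"
      using cU by (subst sum.swap) (simp add: cramer_def qreal_commute mult.assoc)
    also have "\<dots> = padj f T j i" using 3 two[of j i] U by simp
    finally show ?thesis .
  qed
qed

text \<open>The expansion is a real minor times a real diagonal entry minus a Hermitian form, so
  conjugation only reverses factors and renames summation indices.\<close>

lemma pdiag_real:
  assumes f: "herm f" and i: "i \<in> T"
  shows "qreal (pdiag f T i)"
proof -
  let ?S = "T - {i}"
  have c: "cramer f ?S" using IH1 f i by blast
  have "qcnj (pdiag f T i) = f i i * pdet f ?S - (\<Sum>l\<in>?S. \<Sum>k\<in>?S. f i l * (padj f ?S l k * f k i))"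
    unfolding pdiag_def using fin i f c
    by (simp add: padj_mult_expand qcnj_sum hermD cramer_def qreal_def)
  also have "(\<Sum>l\<in>?S. \<Sum>k\<in>?S. f i l * (padj f ?S l k * f k i)) = (\<Sum>k\<in>?S. \<Sum>l\<in>?S. f i l * (padj f ?S l k * f k i))"
    by (rule sum.swap)
  also have "f i i * pdet f ?S - \<dots> = pdiag f T i"
    unfolding pdiag_def using fin i c
    by (simp add: padj_mult_expand cramer_def qreal_commute mult.assoc)
  finally show ?thesis by (simp add: qreal_def)
qed

text \<open>In the expanded double sum the inner product with column \<open>j\<close> collapses by
  Cramer's rule on \<open>T - {i}\<close> and cancels the leading term.\<close>

lemma padj_mult_neq:
  assumes f: "herm f" and ij: "i \<in> T" "j \<in> T" "i \<noteq> j"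
  shows "(\<Sum>l\<in>T. padj f T i l * f l j) = 0"
proof -
  let ?S = "T - {i}"
  have c: "cramer f ?S" using IH1 f ij by blast
  have "(\<Sum>l\<in>?S. \<Sum>k\<in>?S. f i k * padj f ?S k l * f l j) = (\<Sum>k\<in>?S. \<Sum>l\<in>?S. f i k * padj f ?S k l * f l j)"
    by (rule sum.swap)
  also have "\<dots> = (\<Sum>k\<in>?S. f i k * (\<Sum>l\<in>?S. padj f ?S k l * f l j))"
    by (simp add: sum_distrib_left mult.assoc)
  also have "\<dots> = (\<Sum>k\<in>?S. if k = j then f i k * pdet f ?S else 0)"
    using c ij by (intro sum.cong) (auto simp: cramer_def)
  also have "\<dots> = f i j * pdet f ?S" using ij fin by simp
  finally show ?thesis using c ij fin by (simp add: padj_mult_expand cramer_def qreal_commute)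
qed

text \<open>Associativity of \<open>f (padj f T) f\<close> compares the two diagonal entries whenever
  \<open>f i j \<noteq> 0\<close>; otherwise this entry is perturbed.\<close>
lemma pdiag_eq_nonzero:
  assumes f: "herm f" and ij: "i \<in> T" "j \<in> T" "f i j \<noteq> 0"
  shows "pdiag f T i = pdiag f T j"
proof -
  have L: "(\<Sum>l\<in>T. padj f T a l * f l b) = (if a = b then pdiag f T a else 0)" if "a \<in> T" "b \<in> T" for a b
    using padj_mult_neq[OF f that] by (auto simp: pdiag_def)
  have R: "(\<Sum>l\<in>T. f a l * padj f T l b) = (if a = b then pdiag f T a else 0)" if "a \<in> T" "b \<in> T" for a b
  proof -
    have "(\<Sum>l\<in>T. f a l * padj f T l b) = qcnj (\<Sum>l\<in>T. padj f T b l * f l a)"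
      using f by (simp add: qcnj_sum padj_herm hermD)
    also have "\<dots> = (if a = b then pdiag f T a else 0)"
      using that pdiag_real[OF f] by (auto simp: L qreal_def)
    finally show ?thesis .
  qed
  have "f i j * pdiag f T j = (\<Sum>l\<in>T. if l = j then f i l * pdiag f T j else 0)"
    using ij fin by simp
  also have "\<dots> = (\<Sum>l\<in>T. f i l * (\<Sum>k\<in>T. padj f T l k * f k j))"
    using ij by (intro sum.cong) (auto simp: L)
  also have "\<dots> = (\<Sum>k\<in>T. (\<Sum>l\<in>T. f i l * padj f T l k) * f k j)"
    by (simp add: sum_distrib_left sum_distrib_right mult.assoc) (rule sum.swap)
  also have "\<dots> = (\<Sum>k\<in>T. if k = i then pdiag f T i * f k j else 0)"
    using ij by (intro sum.cong) (auto simp: R)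
  also have "\<dots> = pdiag f T i * f i j" using ij fin by simp
  also have "\<dots> = f i j * pdiag f T i" using pdiag_real[OF f ij(1)] by (simp add: qreal_commute)
  finally show ?thesis using ij by simp
qed

lemma pdiag_eq:
  assumes f: "herm f" and ij: "i \<in> T" "j \<in> T"
  shows "pdiag f T i = pdiag f T j"
proof (cases "i = j \<or> f i j \<noteq> 0")
  case True
  then show ?thesis using pdiag_eq_nonzero[OF f ij] by auto
next
  case False
  then have ne: "i \<noteq> j" and z: "f i j = 0" by auto
  have z': "f j i = 0" using hermD[OF f, of i j] z by simp
  \<comment> \<open>Putting the real \<open>t\<close> at both symmetric positions keeps the matrix
    Hermitian, makes the entry nonzero for \<open>t \<noteq> 0\<close>, and gives back
    \<open>f\<close> at \<open>t = 0\<close>.\<close>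
  define g where "g t a b = (if (a, b) = (i, j) \<or> (a, b) = (j, i) then Quat t 0 0 0 else f a b)"
    for t :: real and a b
  have g0: "g 0 = f" using z z' by (auto simp: g_def fun_eq_iff zero_quat_def)
  have gh: "herm (g t)" for t
    using f by (auto simp: herm_def g_def qcnj_def)
  have cont: "qcont0 (\<lambda>t. g t a b)" for a b
  proof -
    have "qcont0 (\<lambda>t. if c then Quat t 0 0 0 else q)" for c q
      by (cases c) simp_all
    then show ?thesis by (simp add: g_def)
  qed
  have "pdiag (g 0) T i = pdiag (g 0) T j"
  proof (rule qcont0_eq_at_0[of "\<lambda>t. pdiag (g t) T i" "\<lambda>t. pdiag (g t) T j"])
    show "qcont0 (\<lambda>t. pdiag (g t) T i)" "qcont0 (\<lambda>t. pdiag (g t) T j)"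
      unfolding pdiag_def by (intro qcont0_sum qcont0_mult qcont0_pdet_padj cont)+
    show "pdiag (g t) T i = pdiag (g t) T j" if "t \<noteq> 0" for t
      using that by (intro pdiag_eq_nonzero gh ij) (simp add: g_def zero_quat_def)
  qed
  then show ?thesis by (simp add: g0)
qed

text \<open>The recursion defines \<open>pdet\<close> as the diagonal entry at the least index;
  since all diagonal entries agree, it is the value of each.\<close>

lemma cramer_T:
  assumes f: "herm f"
  shows "cramer f T"
proof (cases "T = {}")
  case True
  then show ?thesis by (simp add: cramer_def qreal_def padj_outside)
next
  case False
  then have M: "Min T \<in> T" using fin by simp
  have h: "pdiag f T i = pdet f T" if "i \<in> T" for i
    using pdiag_eq[OF f that M] pdet_eq_pdiag[OF fin False] by simp
  have "(\<Sum>l\<in>T. padj f T i l * f l j) = (if i = j then pdet f T else 0)" if "i \<in> T" "j \<in> T" for i j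
    using padj_mult_neq[OF f that] h[OF that(1)] by (auto simp: pdiag_def)
  then show ?thesis unfolding cramer_def
    using padj_herm[OF f] pdiag_real[OF f M] h[OF M] by auto
qed

end

lemma cramer_rule: "finite T \<Longrightarrow> herm f \<Longrightarrow> cramer f T"
proof (induction T arbitrary: f rule: finite_psubset_induct)
  case (psubset T)
  interpret cramer_step T
    by unfold_locales (use psubset in auto)
  show ?case by (rule cramer_T) fact
qed

lemma pdet_real: "finite T \<Longrightarrow> herm f \<Longrightarrow> qreal (pdet f T)"
  using cramer_rule by (simp add: cramer_def)

lemma padj_hermitian: "finite T \<Longrightarrow> herm f \<Longrightarrow> qcnj (padj f T i j) = padj f T j i"
  using cramer_rule by (simp add: cramer_def)

lemma padj_mult_left:
  "finite T \<Longrightarrow> herm f \<Longrightarrow> i \<in> T \<Longrightarrow> j \<in> T \<Longrightarrow>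
    (\<Sum>l\<in>T. padj f T i l * f l j) = (if i = j then pdet f T else 0)"
  using cramer_rule by (simp add: cramer_def)

lemma padj_mult_right:
  "finite T \<Longrightarrow> herm f \<Longrightarrow> i \<in> T \<Longrightarrow> j \<in> T \<Longrightarrow>
    (\<Sum>l\<in>T. f i l * padj f T l j) = (if i = j then pdet f T else 0)"
  by (rule cramer_right[OF cramer_rule])

subsection \<open>Row and column determinants as sums over permutations\<close>

lemma cyc_list_eq_support: "cyc_list p x = support p x"
  by (simp add: cyc_list_def cyc_len_def least_power_def conj_commute)

lemma cyc_list_props:
  assumes p: "permutation p"
  shows "cyc_list p x \<noteq> []" "distinct (cyc_list p x)" "cyc_list p x ! 0 = x" "x \<in> set (cyc_list p x)"
proof -
  note lp = least_power_of_permutation[OF p, of x]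
  show 1: "cyc_list p x \<noteq> []" and 2: "distinct (cyc_list p x)" and 3: "cyc_list p x ! 0 = x"
    using lp cycle_of_permutation[OF p, of x] by (auto simp: cyc_list_eq_support)
  show "x \<in> set (cyc_list p x)"
    using 1 3 by (metis length_greater_0_conv nth_mem)
qed

lemma cyc_list_nth:
  assumes p: "permutation p" and k: "k < length (cyc_list p x)"
  shows "p (cyc_list p x ! k) = cyc_list p x ! (Suc k mod length (cyc_list p x))"
proof -
  note lp = least_power_of_permutation[OF p, of x]
  have "p (cyc_list p x ! k) = (p ^^ Suc k) x" using k by (simp add: cyc_list_eq_support)
  also have "\<dots> = cyc_list p x ! (Suc k mod length (cyc_list p x))"
  proof (cases "Suc k = least_power p x")
    case True
    then have "(p ^^ Suc k) x = x" using lp(1) by metis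
    then show ?thesis using lp(2) by (simp only: cyc_list_eq_support True) simp
  next
    case False
    then have "Suc k < least_power p x" using k by (simp add: cyc_list_eq_support)
    then show ?thesis by (simp only: cyc_list_eq_support length_map length_upt mod_less nth_map_upt) simp
  qed
  finally show ?thesis .
qed

text \<open>Iterating the step condition gives all powers of \<open>p\<close> at \<open>x\<close>,
  and distinctness excludes an earlier return. Cycles of modified permutations are computed below by
  exhibiting such a list.\<close>

lemma cyc_list_unique:
  assumes c: "c \<noteq> []" "distinct c" "c ! 0 = x"
    and step: "\<And>k. k < length c \<Longrightarrow> p (c ! k) = c ! (Suc k mod length c)"
  shows "cyc_list p x = c"
proof -
  have pos: "length c > 0" using c by simp
  have pow: "(p ^^ k) x = c ! (k mod length c)" for k
  proof (induction k)
    case (Suc k)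
    have "(p ^^ Suc k) x = p (c ! (k mod length c))" using Suc by simp
    also have "\<dots> = c ! (Suc (k mod length c) mod length c)" by (rule step) (use pos in simp)
    finally show ?case by (simp add: mod_Suc_eq)
  qed (use c in simp)
  have "cyc_len p x = length c" unfolding cyc_len_def
  proof (rule Least_equality)
    show "0 < length c \<and> (p ^^ length c) x = x" using pos c by (simp add: pow)
    fix k assume k: "0 < k \<and> (p ^^ k) x = x"
    show "length c \<le> k"
    proof (rule ccontr)
      assume "\<not> ?thesis"
      then have "k < length c" by simp
      moreover from this k have "c ! k = c ! 0" using c pow[of k] by simp
      ultimately show False using nth_eq_iff_index_eq[OF c(2), of k 0] pos k by simp
    qed
  qed
  then show ?thesis by (intro nth_equalityI) (auto simp: cyc_list_def pow)
qed

lemma cyc_list_step: "permutation p \<Longrightarrow> y \<in> set (cyc_list p x) \<Longrightarrow> p y \<in> set (cyc_list p x)"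
  by (auto simp: in_set_conv_nth cyc_list_nth) (metis cyc_list_props(1) length_greater_0_conv mod_less_divisor)

lemma cyc_list_set_eq:
  assumes p: "permutation p" and "y \<in> set (cyc_list p x)"
  shows "set (cyc_list p y) = set (cyc_list p x)"
  using disjointD[OF disjoint_support[OF p], of "set (support p y)" "set (support p x)"]
    assms cyc_list_props(4)[OF p, of y] unfolding cyc_list_eq_support by blast

lemma cyc_list_subset:
  assumes p: "p permutes S" and x: "x \<in> S"
  shows "set (cyc_list p x) \<subseteq> S"
  using permutes_in_funpow_image[OF p x] by (auto simp: cyc_list_def)

lemma cyc_list_cong:
  assumes p: "permutation p" and "\<And>y. y \<in> set (cyc_list p x) \<Longrightarrow> q y = p y"
  shows "cyc_list q x = cyc_list p x"
  by (rule cyc_list_unique) (auto simp: cyc_list_props[OF p] cyc_list_nth[OF p] assms(2))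

text \<open>The inverse runs through the cycle backwards; the start \<open>x\<close> stays in front,
  hence only the tail is reversed.\<close>

lemma cyc_list_inv:
  assumes p: "permutation p"
  shows "cyc_list (Hilbert_Choice.inv p) x = x # rev (tl (cyc_list p x))"
proof -
  define c where "c = cyc_list p x"
  note P = cyc_list_props[OF p, of x, folded c_def]
  define n where "n = length c"
  have n: "n > 0" using P by (simp add: n_def)
  have nthc: "(x # rev (tl c)) ! k = c ! ((n - k) mod n)" if "k < n" for k
    using that P(3) n by (cases k) (auto simp: rev_nth nth_tl n_def Suc_diff_Suc)
  have inj: "bij p" using p by (simp add: permutation_bijective)
  show ?thesis unfolding c_def[symmetric]
  proof (rule cyc_list_unique)
    have "distinct (c ! 0 # tl c)" using P(1,2) by (cases c) auto
    then show "distinct (x # rev (tl c))" using P(3) by simp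
    have len: "length (x # rev (tl c)) = n" using n by (simp add: n_def)
    fix k assume "k < length (x # rev (tl c))"
    then have k: "k < n" by (simp only: len)
    \<comment> \<open>Position in the original cycle of the next element of the reversed one; the
      outer \<open>mod\<close> sends \<open>n\<close> to 0 at the wrap-around.\<close>
    define j where "j = (n - Suc k mod n) mod n"
    have j: "j < n" using n by (simp add: j_def)
    have jj: "Suc j mod n = (n - k) mod n"
    proof (cases "Suc k = n")
      case True
      then have "j = 0" "n - k = 1" by (auto simp: j_def)
      then show ?thesis by simp
    next
      case False
      then have "j = n - Suc k" "Suc j = n - k" using k by (auto simp: j_def)
      then show ?thesis by simp
    qed
    have "p (c ! j) = c ! ((n - k) mod n)" using cyc_list_nth[OF p, of j x] j jj by (simp add: n_def c_def)
    then have "Hilbert_Choice.inv p (c ! ((n - k) mod n)) = c ! j" using inj by (metis bij_inv_eq_iff)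
    moreover have "(x # rev (tl c)) ! (Suc k mod n) = c ! j"
      using nthc[of "Suc k mod n"] n by (simp add: j_def)
    ultimately show "Hilbert_Choice.inv p ((x # rev (tl c)) ! k) = (x # rev (tl c)) ! (Suc k mod length (x # rev (tl c)))"
      using nthc[OF k] by (simp only: len)
  qed auto
qed

lemma set_cyc_list_inv: "permutation p \<Longrightarrow> set (cyc_list (Hilbert_Choice.inv p) x) = set (cyc_list p x)"
  using cyc_list_props(1,3)[of p x] by (cases "cyc_list p x") (auto simp: cyc_list_inv)

lemma cyc_prod_eq:
  assumes p: "permutation p"
  shows "cyc_prod F p x = prod_list (map (\<lambda>y. F $$ (y, p y)) (cyc_list p x))"
proof -
  let ?c = "cyc_list p x"
  have "map (\<lambda>y. F $$ (y, p y)) ?c = map (\<lambda>k. F $$ (?c ! k, p (?c ! k))) [0..<length ?c]"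
    by (rule nth_equalityI) auto
  also have "\<dots> = map (\<lambda>k. F $$ (?c ! k, ?c ! ((k + 1) mod length ?c))) [0..<length ?c]"
    using cyc_list_nth[OF p] by simp
  finally show ?thesis by (simp add: cyc_prod_def Let_def)
qed

lemma qcnj_prod_list: "qcnj (prod_list xs) = prod_list (rev (map qcnj xs))"
  by (induction xs) auto

text \<open>Conjugation reverses the factors and inversion reverses the cycle, so both sides list
  the same conjugated entries in the same order.\<close>

lemma cyc_prod_qadj_inv:
  assumes p: "permutation p" and F: "F \<in> carrier_mat n n" and sub: "set (cyc_list p x) \<subseteq> {..<n}"
  shows "cyc_prod (qadj F) (Hilbert_Choice.inv p) x = qcnj (cyc_prod F p x)"
proof -
  let ?c = "cyc_list p x"
  note P = cyc_list_props[OF p, of x]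
  have bij: "bij p" using p by (simp add: permutation_bijective)
  \<comment> \<open>Replacing each point by its predecessor under \<open>p\<close> turns the inverse
    cycle into the reversal of the whole cycle, \<open>x\<close> included.\<close>
  have *: "map (Hilbert_Choice.inv p) (x # rev (tl ?c)) = rev ?c"
  proof -
    have "map p (rev ?c) = x # rev (tl ?c)"
    proof -
      have "map p ?c = rotate1 ?c"
        using P(1) cyc_list_nth[OF p, of _ x] by (intro nth_equalityI) (auto simp: nth_rotate1)
      also have "\<dots> = tl ?c @ [x]" using P(1,3) by (cases ?c) auto
      finally show ?thesis by (simp add: rev_map[symmetric])
    qed
    then have "map (Hilbert_Choice.inv p) (x # rev (tl ?c)) = map (Hilbert_Choice.inv p) (map p (rev ?c))" by simp
    also have "\<dots> = rev ?c" using bij by (simp add: bij_is_inj map_idI)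
    finally show ?thesis .
  qed
  have pinv: "permutation (Hilbert_Choice.inv p)" using p by (simp add: permutation_inverse)
  have "cyc_prod (qadj F) (Hilbert_Choice.inv p) x = prod_list (map (\<lambda>y. qadj F $$ (y, Hilbert_Choice.inv p y)) (cyc_list (Hilbert_Choice.inv p) x))"
    by (rule cyc_prod_eq[OF pinv])
  also have "map (\<lambda>y. qadj F $$ (y, Hilbert_Choice.inv p y)) (cyc_list (Hilbert_Choice.inv p) x)
      = map (\<lambda>z. qadj F $$ (p z, z)) (map (Hilbert_Choice.inv p) (cyc_list (Hilbert_Choice.inv p) x))"
    using bij by (simp add: bij_inv_eq_iff o_def surj_f_inv_f bij_is_surj)
  also have "\<dots> = map (\<lambda>z. qadj F $$ (p z, z)) (rev ?c)"
    by (simp only: cyc_list_inv[OF p] *)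
  also have "\<dots> = map (\<lambda>z. qcnj (F $$ (z, p z))) (rev ?c)"
  proof (rule map_cong[OF refl])
    fix z assume "z \<in> set (rev ?c)"
    then have "z < n" "p z < n" using sub cyc_list_step[OF p, of z x] by auto
    then show "qadj F $$ (p z, z) = qcnj (F $$ (z, p z))" using F by (simp add: qadj_def)
  qed
  finally show ?thesis by (simp add: cyc_prod_eq[OF p] qcnj_prod_list rev_map o_def)
qed

text \<open>Composing with the transposition splices the new point \<open>i\<close> into the cycle
  of \<open>l\<close>, just before \<open>l\<close>: the former predecessor of \<open>l\<close> goes
  to \<open>i\<close>, and \<open>i\<close> goes to \<open>l\<close>.\<close>

context
  fixes S :: "nat set" and q p :: "nat \<Rightarrow> nat" and i l :: nat
  assumes fin: "finite S" and q: "q permutes S" and i: "i \<notin> S" and l: "l \<in> S"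
    and p: "p = transpose i l \<circ> q"
begin

lemma permutation_q: "permutation q"
  using fin q by (rule permutes_imp_permutation)

lemma permutes_p: "p permutes insert i S"
  unfolding p using permutes_subset[OF q, of "insert i S"] l
  by (intro permutes_compose permutes_swap_id) auto

lemma permutation_p: "permutation p"
  using permutes_p fin permutes_imp_permutation by (metis finite_insert)

lemma p_i: "p i = l"
  using permutes_not_in[OF q i] by (simp add: p)

lemma p_in: "x \<in> S \<Longrightarrow> p x = (if q x = l then i else q x)"
  using permutes_in_image[OF q, of x] i by (auto simp: p transpose_def)

lemma cyc_list_insert: "cyc_list p i = i # cyc_list q l"
proof -
  let ?c = "cyc_list q l"
  note P = cyc_list_props[OF permutation_q, of l]
  have sub: "set ?c \<subseteq> S" by (rule cyc_list_subset[OF q l])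
  show ?thesis
  proof (rule cyc_list_unique)
    show "distinct (i # ?c)" using P(2) sub i by auto
    fix k assume k: "k < length (i # ?c)"
    show "p ((i # ?c) ! k) = (i # ?c) ! (Suc k mod length (i # ?c))"
    proof (cases k)
      case 0
      then show ?thesis using P(1,3) by (simp add: p_i)
    next
      case (Suc j)
      then have j: "j < length ?c" using k by simp
      then have inS: "?c ! j \<in> S" using sub by (meson nth_mem subsetD)
      \<comment> \<open>Only the closing step changes: the last point used to return to
        \<open>l\<close> and now goes to \<open>i\<close>.\<close>
      show ?thesis
      proof (cases "Suc j = length ?c")
        case True
        then have "q (?c ! j) = l" using P(3) cyc_list_nth[OF permutation_q j] by simp
        then show ?thesis using inS unfolding Suc nth_Cons_Suc by (simp add: p_in True)
      next
        case False
        then have j': "Suc j < length ?c" using j by simp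
        then have "q (?c ! j) = ?c ! Suc j" using cyc_list_nth[OF permutation_q j] by simp
        moreover have "?c ! Suc j \<noteq> ?c ! 0" using P(1,2) j' by (subst nth_eq_iff_index_eq) auto
        ultimately show ?thesis using Suc inS P(3) j' by (simp add: p_in)
      qed
    qed
  qed auto
qed

lemma cyc_list_other:
  assumes x: "x \<in> S" "x \<notin> set (cyc_list q l)"
  shows "cyc_list p x = cyc_list q x" "\<And>y. y \<in> set (cyc_list q x) \<Longrightarrow> p y = q y"
proof -
  show *: "p y = q y" if y: "y \<in> set (cyc_list q x)" for y
  proof -
    have "q y \<in> set (cyc_list q x)" by (rule cyc_list_step[OF permutation_q y])
    then have "q y \<noteq> l"
      using cyc_list_set_eq[OF permutation_q, of l x] x cyc_list_props(4)[OF permutation_q, of x] by auto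
    moreover have "y \<in> S" using cyc_list_subset[OF q x(1)] y by auto
    ultimately show ?thesis by (simp add: p_in)
  qed
  then show "cyc_list p x = cyc_list q x" by (intro cyc_list_cong permutation_q)
qed

text \<open>Cycles of \<open>q\<close> avoiding \<open>l\<close> are untouched, so the remaining
  factors and their order by leaders are the same for both permutations.\<close>

lemma cyc_leaders_insert:
  "cyc_leaders p (insert i S) - set (cyc_list p i) = cyc_leaders q S - set (cyc_list q l)"
  using cyc_list_subset[OF q l] i
  by (auto simp: cyc_leaders_def cyc_list_insert cyc_list_other(1))

end

text \<open>Cycles are disjoint and each is led by its minimum, so deleting the cycle through
  \<open>x\<close> removes exactly one leader.\<close>

lemma card_cyc_leaders:
  assumes fin: "finite T" and p: "p permutes T" and x: "x \<in> T"
  shows "cyc_leaders p T \<inter> set (cyc_list p x) = {Min (set (cyc_list p x))}"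
    and "card (cyc_leaders p T) = Suc (card (cyc_leaders p T - set (cyc_list p x)))"
proof -
  let ?O = "set (cyc_list p x)"
  have perm: "permutation p" using fin p by (rule permutes_imp_permutation)
  have M: "Min ?O \<in> ?O" using cyc_list_props(1)[OF perm, of x] by (intro Min_in) auto
  have "Min ?O \<in> T" using M cyc_list_subset[OF p x] by auto
  then show 1: "cyc_leaders p T \<inter> ?O = {Min ?O}"
    using M cyc_list_set_eq[OF perm] by (auto simp: cyc_leaders_def)
  have "finite (cyc_leaders p T)" using fin by (simp add: cyc_leaders_def)
  then have "card (cyc_leaders p T) = card (cyc_leaders p T \<inter> ?O) + card (cyc_leaders p T - ?O)"
    by (rule card_Int_Diff)
  then show "card (cyc_leaders p T) = Suc (card (cyc_leaders p T - ?O))" by (simp add: 1)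
qed

text \<open>Splicing enlarges the index set by one and leaves the number of cycles
  unchanged.\<close>

lemma psign_insert:
  assumes "finite S" "q permutes S" "i \<notin> S" "l \<in> S" "p = transpose i l \<circ> q"
  shows "psign (insert i S) p = - psign S q"
proof -
  have pp: "p permutes insert i S" using permutes_p[OF assms] .
  have "card (cyc_leaders p (insert i S)) = Suc (card (cyc_leaders q S - set (cyc_list q l)))"
    using card_cyc_leaders(2)[OF _ pp, of i] assms(1) by (simp add: cyc_leaders_insert[OF assms])
  also have "\<dots> = card (cyc_leaders q S)"
    using card_cyc_leaders(2)[OF assms(1,2,4)] by simp
  finally have "card (cyc_leaders p (insert i S)) = card (cyc_leaders q S)" .
  moreover have "card (cyc_leaders q S) \<le> card S"
    using assms(1) by (intro card_mono) (auto simp: cyc_leaders_def)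
  ultimately show ?thesis using assms by (simp add: psign_def Suc_diff_le)
qed

lemma cyc_list_fixpoint: "p x = x \<Longrightarrow> cyc_list p x = [x]"
  by (rule cyc_list_unique) auto

lemma cyc_leaders_insert_fixpoint:
  assumes "q permutes S" "i \<notin> S"
  shows "cyc_leaders q (insert i S) = insert i (cyc_leaders q S)" "i \<notin> cyc_leaders q S"
  using permutes_not_in[OF assms] assms(2) by (auto simp: cyc_leaders_def cyc_list_fixpoint)

text \<open>A new fixed point adds one index and one cycle, which cancel in the exponent.\<close>

lemma psign_insert_fixpoint:
  assumes "finite S" "q permutes S" "i \<notin> S"
  shows "psign (insert i S) q = psign S q"
proof -
  have "finite (cyc_leaders q S)" using assms(1) by (simp add: cyc_leaders_def)
  then show ?thesis using assms by (simp add: psign_def cyc_leaders_insert_fixpoint)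
qed

text \<open>The counterpart of \<open>hdet\<close> with the order of the cycles reversed, matching
  \<open>cdet\<close>. It arises as the conjugate of \<open>hdet\<close> and as the cofactor in the
  expansion below.\<close>

definition ddet :: "nat set \<Rightarrow> quat mat \<Rightarrow> quat" where
  "ddet S F = (\<Sum>p\<in>{p. p permutes S}. psign S p *
      prod_list (map (cyc_prod F p) (rev (sorted_list_of_set (cyc_leaders p S)))))"

text \<open>The column determinant at \<open>l\<close> with the entries of column \<open>l\<close> given by \<open>b\<close> and a factor \<open>w\<close>
  in front of the last cycle: peeling off the first entry of that cycle moves it into \<open>w\<close>, as it
  does not commute with the other cycles.\<close>
definition wcdet :: "nat set \<Rightarrow> nat \<Rightarrow> quat \<Rightarrow> quat mat \<Rightarrow> (nat \<Rightarrow> quat) \<Rightarrow> quat" where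
  "wcdet S l w F b = (\<Sum>p\<in>{p. p permutes S}. psign S p *
      (prod_list (map (cyc_prod F p) (rev (sorted_list_of_set (cyc_leaders p S - set (cyc_list p l))))) *
       w * prod_list (map (\<lambda>y. if p y = l then b y else F $$ (y, p y)) (cyc_list p l))))"

text \<open>Permutations are sorted by the image of \<open>i\<close>. If \<open>i\<close> is fixed,
  the rest is \<open>ddet\<close> on \<open>S\<close>; if it goes to \<open>l\<close>, removing
  \<open>i\<close> from its cycle leaves a permutation of \<open>S\<close>, the entry
  \<open>F $$ (i, l)\<close> passes into the weight, and the sign flips.\<close>

lemma wcdet_insert:
  assumes fin: "finite S" and i: "i \<notin> S"
  shows "wcdet (insert i S) i w F b = ddet S F * w * b i - (\<Sum>l\<in>S. wcdet S l (w * F $$ (i, l)) F b)"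
proof -
  define t where "t p = psign (insert i S) p *
      (prod_list (map (cyc_prod F p) (rev (sorted_list_of_set (cyc_leaders p (insert i S) - set (cyc_list p i))))) *
       w * prod_list (map (\<lambda>y. if p y = i then b y else F $$ (y, p y)) (cyc_list p i)))" for p
  have "wcdet (insert i S) i w F b
      = (\<Sum>l\<in>insert i S. \<Sum>q\<in>{p. p permutes S}. t (transpose i l \<circ> q))"
    unfolding wcdet_def t_def by (rule sum_over_permutations_insert[OF fin i])
  also have "\<dots> = (\<Sum>q\<in>{p. p permutes S}. t q) + (\<Sum>l\<in>S. \<Sum>q\<in>{p. p permutes S}. t (transpose i l \<circ> q))"
    using fin i by simp
  also have "(\<Sum>q\<in>{p. p permutes S}. t q) = ddet S F * w * b i"
    unfolding ddet_def sum_distrib_right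
  proof (rule sum.cong[OF refl])
    fix q assume "q \<in> {p. p permutes S}"
    then have q: "q permutes S" by simp
    have "q i = i" using permutes_not_in[OF q i] .
    then show "t q = psign S q * prod_list (map (cyc_prod F q) (rev (sorted_list_of_set (cyc_leaders q S)))) * w * b i"
      using cyc_leaders_insert_fixpoint[OF q i]
      by (simp add: t_def psign_insert_fixpoint[OF fin q i] cyc_list_fixpoint mult.assoc)
  qed
  finally have expand: "wcdet (insert i S) i w F b = ddet S F * w * b i
      + (\<Sum>l\<in>S. \<Sum>q\<in>{p. p permutes S}. t (transpose i l \<circ> q))" .
  have "(\<Sum>q\<in>{p. p permutes S}. t (transpose i l \<circ> q)) = - wcdet S l (w * F $$ (i, l)) F b"
    if l: "l \<in> S" for l
    unfolding wcdet_def sum_negf[symmetric]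
  proof (rule sum.cong[OF refl])
    fix q assume "q \<in> {p. p permutes S}"
    then have q: "q permutes S" by simp
    define p where "p = transpose i l \<circ> q"
    note A = fin q i l p_def
    have L: "cyc_leaders p (insert i S) - set (cyc_list p i) = cyc_leaders q S - set (cyc_list q l)"
      by (rule cyc_leaders_insert[OF A])
    have C: "cyc_prod F p x = cyc_prod F q x" if "x \<in> cyc_leaders q S - set (cyc_list q l)" for x
    proof -
      have x: "x \<in> S" "x \<notin> set (cyc_list q l)" using that by (auto simp: cyc_leaders_def)
      show ?thesis using cyc_list_other[OF A x]
        by (auto simp: cyc_prod_eq[OF permutation_p[OF A]] cyc_prod_eq[OF permutation_q[OF A]]
            cong: map_cong)
    qed
    have fl: "finite (cyc_leaders q S - set (cyc_list q l))" using fin by (simp add: cyc_leaders_def)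
    have M: "map (cyc_prod F p) (rev (sorted_list_of_set (cyc_leaders q S - set (cyc_list q l))))
        = map (cyc_prod F q) (rev (sorted_list_of_set (cyc_leaders q S - set (cyc_list q l))))"
      using fl C by (intro map_cong) auto
    have il: "l \<noteq> i" using i l by auto
    \<comment> \<open>Entering \<open>i\<close> after splicing is the same as entering
      \<open>l\<close> before, so \<open>b\<close> replaces the same factor.\<close>
    have N: "map (\<lambda>y. if p y = i then b y else F $$ (y, p y)) (cyc_list q l)
       = map (\<lambda>y. if q y = l then b y else F $$ (y, q y)) (cyc_list q l)"
    proof (rule map_cong[OF refl])
      fix y assume "y \<in> set (cyc_list q l)"
      then have y: "y \<in> S" using cyc_list_subset[OF q l] by auto
      then have "q y \<noteq> i" using permutes_in_image[OF q] i by metis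
      then show "(if p y = i then b y else F $$ (y, p y)) = (if q y = l then b y else F $$ (y, q y))"
        using p_in[OF A y] by auto
    qed
    have "t p = - psign S q * (prod_list (map (cyc_prod F q) (rev (sorted_list_of_set (cyc_leaders q S - set (cyc_list q l))))) *
       w * (F $$ (i, l) * prod_list (map (\<lambda>y. if q y = l then b y else F $$ (y, q y)) (cyc_list q l))))"
      unfolding t_def L M using il by (simp add: cyc_list_insert[OF A] N psign_insert[OF A] p_i[OF A])
    then show "t (transpose i l \<circ> q) = - (psign S q *
      (prod_list (map (cyc_prod F q) (rev (sorted_list_of_set (cyc_leaders q S - set (cyc_list q l))))) *
       (w * F $$ (i, l)) * prod_list (map (\<lambda>y. if q y = l then b y else F $$ (y, q y)) (cyc_list q l))))"
      by (simp add: p_def mult.assoc)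
  qed
  then have "(\<Sum>l\<in>S. \<Sum>q\<in>{p. p permutes S}. t (transpose i l \<circ> q))
      = - (\<Sum>l\<in>S. wcdet S l (w * F $$ (i, l)) F b)"
    unfolding sum_negf[symmetric] by (intro sum.cong[OF refl])
  then show ?thesis unfolding expand by simp
qed

text \<open>Column \<open>i\<close> is entered only in the cycle through \<open>i\<close>, so the
  replacement leaves all other cycles alone.\<close>

lemma cdet_col_repl:
  assumes F: "F \<in> carrier_mat n n" and T: "T \<subseteq> {..<n}" and i: "i \<in> T"
  shows "cdet T i (col_repl F i b) = wcdet T i 1 F (\<lambda>y. b $ y)"
  unfolding cdet_def wcdet_def
proof (rule sum.cong[OF refl])
  fix p assume "p \<in> {p. p permutes T}"
  then have p: "p permutes T" by simp
  have fin: "finite T" using T by (rule finite_subset) simp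
  have perm: "permutation p" using fin p by (rule permutes_imp_permutation)
  have ent: "col_repl F i b $$ (y, p y) = (if p y = i then b $ y else F $$ (y, p y))" if "y \<in> T" for y
  proof -
    have "y < n" "p y < n" using that permutes_in_image[OF p, of y] T by auto
    then show ?thesis using F by (simp add: col_repl_def)
  qed
  have 1: "map (cyc_prod (col_repl F i b) p) (rev (sorted_list_of_set (cyc_leaders p T - set (cyc_list p i))))
      = map (cyc_prod F p) (rev (sorted_list_of_set (cyc_leaders p T - set (cyc_list p i))))"
  proof (rule map_cong[OF refl])
    fix x assume "x \<in> set (rev (sorted_list_of_set (cyc_leaders p T - set (cyc_list p i))))"
    then have x: "x \<in> T" "x \<notin> set (cyc_list p i)" using fin by (auto simp: cyc_leaders_def)
    have "col_repl F i b $$ (y, p y) = F $$ (y, p y)" if y: "y \<in> set (cyc_list p x)" for y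
    proof -
      have "p y \<noteq> i" using cyc_list_step[OF perm y] cyc_list_set_eq[OF perm, of i x] x
          cyc_list_props(4)[OF perm, of x] by auto
      then show ?thesis using ent[of y] cyc_list_subset[OF p x(1)] y by auto
    qed
    then show "cyc_prod (col_repl F i b) p x = cyc_prod F p x"
      by (simp add: cyc_prod_eq[OF perm] cong: map_cong)
  qed
  have 2: "cyc_prod (col_repl F i b) p i
      = prod_list (map (\<lambda>y. if p y = i then b $ y else F $$ (y, p y)) (cyc_list p i))"
    using cyc_list_subset[OF p i] ent unfolding cyc_prod_eq[OF perm]
    by (intro arg_cong[of _ _ prod_list] map_cong) auto
  show "psign T p * (prod_list (map (cyc_prod (col_repl F i b) p)
          (rev (sorted_list_of_set (cyc_leaders p T - set (cyc_list p i))))) * cyc_prod (col_repl F i b) p i)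
      = psign T p * (prod_list (map (cyc_prod F p)
          (rev (sorted_list_of_set (cyc_leaders p T - set (cyc_list p i))))) * 1 *
         prod_list (map (\<lambda>y. if p y = i then b $ y else F $$ (y, p y)) (cyc_list p i)))"
    by (simp add: 1 2)
qed

text \<open>The least index leads its own cycle and is the smallest leader, so in decreasing order
  this cycle comes last, as in a column determinant at \<open>Min T\<close>.\<close>

lemma ddet_eq_wcdet:
  assumes fin: "finite T" and ne: "T \<noteq> {}"
  shows "ddet T F = wcdet T (Min T) 1 F (\<lambda>y. F $$ (y, Min T))"
  unfolding ddet_def wcdet_def
proof (rule sum.cong[OF refl])
  fix p assume "p \<in> {p. p permutes T}"
  then have p: "p permutes T" by simp
  define m where "m = Min T"
  define L where "L = cyc_leaders p T"
  have perm: "permutation p" using fin p by (rule permutes_imp_permutation)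
  have m: "m \<in> T" using fin ne by (simp add: m_def)
  have "Min (set (cyc_list p m)) = m"
    using cyc_list_subset[OF p m] cyc_list_props(4)[OF perm, of m] fin
    by (intro Min_eqI) (auto simp: m_def)
  then have Lm: "L \<inter> set (cyc_list p m) = {m}"
    using card_cyc_leaders(1)[OF fin p m] by (simp add: L_def)
  have finL: "finite L" "\<And>x. x \<in> L \<Longrightarrow> m \<le> x"
    using fin by (auto simp: L_def cyc_leaders_def m_def)
  have "Min L = m" using Lm finL by (intro Min_eqI) auto
  moreover have "L \<noteq> {}" "L - set (cyc_list p m) = L - {m}" using Lm by auto
  ultimately have sl: "sorted_list_of_set L = m # sorted_list_of_set (L - set (cyc_list p m))"
    using sorted_list_of_set_nonempty[OF finL(1)] by simp
  have "cyc_prod F p m = prod_list (map (\<lambda>y. if p y = m then F $$ (y, m) else F $$ (y, p y)) (cyc_list p m))"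
    unfolding cyc_prod_eq[OF perm] by (intro arg_cong[of _ _ prod_list] map_cong) auto
  then show "psign T p * prod_list (map (cyc_prod F p) (rev (sorted_list_of_set (cyc_leaders p T)))) =
    psign T p * (prod_list (map (cyc_prod F p) (rev (sorted_list_of_set (cyc_leaders p T - set (cyc_list p (Min T)))))) * 1 *
       prod_list (map (\<lambda>y. if p y = Min T then F $$ (y, Min T) else F $$ (y, p y)) (cyc_list p (Min T))))"
    unfolding m_def[symmetric] L_def[symmetric] sl by simp
qed

text \<open>Under induction on \<open>T\<close>, peeling off an entry reproduces the recursion of
  \<open>padj\<close>. The weight has to be arbitrary because it collects the peeled
  entries.\<close>

lemma wcdet_eq_padj:
  assumes "finite T" "herm f" "\<And>i j. i \<in> T \<Longrightarrow> j \<in> T \<Longrightarrow> F $$ (i, j) = f i j"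
  shows "ddet T F = pdet f T"
    and "i \<in> T \<Longrightarrow> wcdet T i w F b = w * (\<Sum>j\<in>T. padj f T i j * b j)"
proof -
  have "ddet T F = pdet f T \<and> (\<forall>i\<in>T. \<forall>w b. wcdet T i w F b = w * (\<Sum>j\<in>T. padj f T i j * b j))"
    using assms(1,3)
  proof (induction T rule: finite_psubset_induct)
    case (psubset T)
    have W: "wcdet T i w F b = w * (\<Sum>j\<in>T. padj f T i j * b j)" if i: "i \<in> T" for i w b
    proof -
      let ?S = "T - {i}"
      have IH: "ddet ?S F = pdet f ?S"
        "\<And>l w b. l \<in> ?S \<Longrightarrow> wcdet ?S l w F b = w * (\<Sum>j\<in>?S. padj f ?S l j * b j)"
        using psubset.IH[of ?S] i psubset.prems by auto
      \<comment> \<open>The cofactor of \<open>b i\<close> stands to the left of the weight; its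
        reality lets it move past.\<close>
      have real: "pdet f ?S * w = w * pdet f ?S"
        using pdet_real[of ?S f] psubset.hyps assms(2) by (simp add: qreal_commute)
      have "(\<Sum>l\<in>?S. wcdet ?S l (w * F $$ (i, l)) F b)
          = (\<Sum>l\<in>?S. \<Sum>j\<in>?S. w * (f i l * padj f ?S l j * b j))"
        using psubset.prems i by (intro sum.cong) (auto simp: IH(2) sum_distrib_left mult.assoc)
      also have "\<dots> = (\<Sum>j\<in>?S. \<Sum>l\<in>?S. w * (f i l * padj f ?S l j * b j))"
        by (rule sum.swap)
      also have "\<dots> = - (w * (\<Sum>j\<in>?S. padj f T i j * b j))"
        using i psubset.hyps
        by (simp add: padj_neq sum_distrib_left sum_distrib_right mult.assoc sum_negf)
      finally have "wcdet T i w F b = pdet f ?S * w * b i + w * (\<Sum>j\<in>?S. padj f T i j * b j)"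
        using wcdet_insert[of ?S i w F b] psubset.hyps i by (simp add: insert_absorb IH(1))
      also have "\<dots> = w * (\<Sum>j\<in>T. padj f T i j * b j)"
        using i psubset.hyps by (simp add: real sum.remove[of T i] padj_same distrib_left mult.assoc)
      finally show ?thesis .
    qed
    moreover have "ddet T F = pdet f T"
    proof (cases "T = {}")
      case True
      then show ?thesis by (simp add: ddet_def psign_def cyc_leaders_def)
    next
      case False
      then have M: "Min T \<in> T" using psubset.hyps by simp
      show ?thesis
        using M psubset.prems
        by (simp add: ddet_eq_wcdet[OF psubset.hyps False] W[OF M] pdet_eq_pdiag[OF psubset.hyps False] pdiag_def)
    qed
    ultimately show ?case by blast
  qed
  then show "ddet T F = pdet f T"
    and "i \<in> T \<Longrightarrow> wcdet T i w F b = w * (\<Sum>j\<in>T. padj f T i j * b j)" by auto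
qed

section \<open>Conjugate transposition of row and column determinants\<close>

lemma cyc_leaders_inv: "permutation p \<Longrightarrow> cyc_leaders (Hilbert_Choice.inv p) S = cyc_leaders p S"
  by (simp add: cyc_leaders_def set_cyc_list_inv)

lemma psign_inv: "permutation p \<Longrightarrow> psign S (Hilbert_Choice.inv p) = psign S p"
  by (simp add: psign_def cyc_leaders_inv)

lemma psign_cases: "psign S p = 1 \<or> psign S p = - 1"
  unfolding psign_def by (cases "even (card S - card (cyc_leaders p S))") auto

lemma qcnj_psign_mult: "qcnj (psign S p * x) = psign S p * qcnj x"
  using psign_cases[of S p] by auto

lemma qcnj_prod_cyc_prod:
  assumes F: "F \<in> carrier_mat n n" and T: "T \<subseteq> {..<n}" and p: "p permutes T" and L: "L \<subseteq> T"
  shows "qcnj (prod_list (map (cyc_prod F p) (sorted_list_of_set L)))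
    = prod_list (map (cyc_prod (qadj F) (Hilbert_Choice.inv p)) (rev (sorted_list_of_set L)))"
proof -
  have fin: "finite T" using T by (rule finite_subset) simp
  have perm: "permutation p" using fin p by (rule permutes_imp_permutation)
  have "finite L" using L fin by (rule finite_subset)
  then have M: "map (cyc_prod (qadj F) (Hilbert_Choice.inv p)) (rev (sorted_list_of_set L))
      = map (\<lambda>x. qcnj (cyc_prod F p x)) (rev (sorted_list_of_set L))"
    using L T cyc_list_subset[OF p] by (intro map_cong cyc_prod_qadj_inv[OF perm F]) fastforce+
  show ?thesis by (simp only: M qcnj_prod_list rev_map map_map o_def)
qed

text \<open>Summation over inverse permutations matches the terms: conjugation reverses each cycle
  and the order of the cycles, so the distinguished first cycle becomes the last one.\<close>

lemma qcnj_rdet: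
  assumes F: "F \<in> carrier_mat n n" and T: "T \<subseteq> {..<n}" and i: "i \<in> T"
  shows "qcnj (rdet T i F) = cdet T i (qadj F)"
proof -
  have fin: "finite T" using T by (rule finite_subset) simp
  have "cdet T i (qadj F) = (\<Sum>p\<in>{p. p permutes T}. psign T (Hilbert_Choice.inv p) *
      (prod_list (map (cyc_prod (qadj F) (Hilbert_Choice.inv p)) (rev (sorted_list_of_set (cyc_leaders (Hilbert_Choice.inv p) T - set (cyc_list (Hilbert_Choice.inv p) i))))) *
       cyc_prod (qadj F) (Hilbert_Choice.inv p) i))"
    unfolding cdet_def by (rule sum_permutations_inverse)
  also have "\<dots> = qcnj (rdet T i F)"
    unfolding rdet_def qcnj_sum
  proof (rule sum.cong[OF refl])
    fix p assume "p \<in> {p. p permutes T}"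
    then have p: "p permutes T" by simp
    have perm: "permutation p" using fin p by (rule permutes_imp_permutation)
    have "cyc_prod (qadj F) (Hilbert_Choice.inv p) i = qcnj (cyc_prod F p i)"
      using cyc_list_subset[OF p i] T by (intro cyc_prod_qadj_inv[OF perm F]) auto
    moreover have "cyc_leaders p T - set (cyc_list p i) \<subseteq> T" by (auto simp: cyc_leaders_def)
    ultimately show "psign T (Hilbert_Choice.inv p) *
      (prod_list (map (cyc_prod (qadj F) (Hilbert_Choice.inv p)) (rev (sorted_list_of_set (cyc_leaders (Hilbert_Choice.inv p) T - set (cyc_list (Hilbert_Choice.inv p) i))))) *
       cyc_prod (qadj F) (Hilbert_Choice.inv p) i) = qcnj (psign T p *
      (cyc_prod F p i * prod_list (map (cyc_prod F p) (sorted_list_of_set (cyc_leaders p T - set (cyc_list p i))))))"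
      by (subst qcnj_psign_mult) (simp add: psign_inv[OF perm] cyc_leaders_inv[OF perm] set_cyc_list_inv[OF perm]
          qcnj_prod_cyc_prod[OF F T p])
  qed
  finally show ?thesis by simp
qed

lemma qcnj_hdet:
  assumes F: "F \<in> carrier_mat n n" and T: "T \<subseteq> {..<n}"
  shows "qcnj (hdet T F) = ddet T (qadj F)"
proof -
  have fin: "finite T" using T by (rule finite_subset) simp
  have "ddet T (qadj F) = (\<Sum>p\<in>{p. p permutes T}. psign T (Hilbert_Choice.inv p) *
      prod_list (map (cyc_prod (qadj F) (Hilbert_Choice.inv p)) (rev (sorted_list_of_set (cyc_leaders (Hilbert_Choice.inv p) T)))))"
    unfolding ddet_def by (rule sum_permutations_inverse)
  also have "\<dots> = qcnj (hdet T F)"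
    unfolding hdet_def qcnj_sum
  proof (rule sum.cong[OF refl])
    fix p assume "p \<in> {p. p permutes T}"
    then have p: "p permutes T" by simp
    have perm: "permutation p" using fin p by (rule permutes_imp_permutation)
    have "cyc_leaders p T \<subseteq> T" by (auto simp: cyc_leaders_def)
    then show "psign T (Hilbert_Choice.inv p) *
      prod_list (map (cyc_prod (qadj F) (Hilbert_Choice.inv p)) (rev (sorted_list_of_set (cyc_leaders (Hilbert_Choice.inv p) T)))) =
      qcnj (psign T p * prod_list (map (cyc_prod F p) (sorted_list_of_set (cyc_leaders p T))))"
      by (subst qcnj_psign_mult) (simp add: psign_inv[OF perm] cyc_leaders_inv[OF perm] qcnj_prod_cyc_prod[OF F T p])
  qed
  finally show ?thesis by simp
qed

subsection \<open>Gram matrices and rank\<close>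

lemma qadj_carrier [simp]: "A \<in> carrier_mat m n \<Longrightarrow> qadj A \<in> carrier_mat n m"
  by (simp add: qadj_def)

lemma dim_qadj [simp]: "dim_row (qadj A) = dim_col A" "dim_col (qadj A) = dim_row A"
  by (simp_all add: qadj_def)

lemma index_qadj [simp]: "i < dim_col A \<Longrightarrow> j < dim_row A \<Longrightarrow> qadj A $$ (i, j) = qcnj (A $$ (j, i))"
  by (simp add: qadj_def)

lemma qadj_qadj [simp]: "qadj (qadj A) = A"
  by (rule eq_matI) auto

lemma qadj_zero [simp]: "qadj (0\<^sub>m m n) = 0\<^sub>m n m"
  by (rule eq_matI) auto

lemma index_mult_mat_sum:
  assumes "A \<in> carrier_mat m n" "B \<in> carrier_mat n p" "i < m" "j < p"
  shows "(A * B) $$ (i, j) = (\<Sum>k<n. A $$ (i, k) * B $$ (k, j))"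
  using assms by (auto simp: scalar_prod_def atLeast0LessThan intro!: sum.cong)

lemma qadj_mult:
  assumes A: "A \<in> carrier_mat m n" and B: "B \<in> carrier_mat n p"
  shows "qadj (A * B) = qadj B * qadj A"
proof (rule eq_matI)
  fix i j assume "i < dim_row (qadj B * qadj A)" "j < dim_col (qadj B * qadj A)"
  then have ij: "i < p" "j < m" using A B by auto
  have "qadj (A * B) $$ (i, j) = qcnj ((A * B) $$ (j, i))" using A B ij by simp
  also have "\<dots> = (\<Sum>k<n. qcnj (B $$ (k, i)) * qcnj (A $$ (j, k)))"
    by (subst index_mult_mat_sum[OF A B ij(2,1)]) (simp add: qcnj_sum)
  also have "\<dots> = (qadj B * qadj A) $$ (i, j)"
    using A B ij by (subst index_mult_mat_sum[of _ p n _ m]) auto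
  finally show "qadj (A * B) $$ (i, j) = (qadj B * qadj A) $$ (i, j)" .
qed (use A B in auto)

lemma mult_smult_real:
  assumes A: "A \<in> carrier_mat m n" and B: "B \<in> carrier_mat n p" and c: "qreal c"
  shows "A * (c \<cdot>\<^sub>m B) = c \<cdot>\<^sub>m (A * B)"
proof (rule eq_matI)
  fix i j assume "i < dim_row (c \<cdot>\<^sub>m (A * B))" "j < dim_col (c \<cdot>\<^sub>m (A * B))"
  then have ij: "i < m" "j < p" using A B by auto
  have "A $$ (i, k) * (c * B $$ (k, j)) = c * (A $$ (i, k) * B $$ (k, j))" for k
    using qreal_commute[OF c, of "A $$ (i, k)"] by (simp flip: mult.assoc)
  then have "(\<Sum>k<n. A $$ (i, k) * (c \<cdot>\<^sub>m B) $$ (k, j)) = c * (\<Sum>k<n. A $$ (i, k) * B $$ (k, j))"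
    using B ij by (simp add: sum_distrib_left)
  moreover have "(c \<cdot>\<^sub>m (A * B)) $$ (i, j) = c * (A * B) $$ (i, j)" using A B ij by simp
  ultimately show "(A * (c \<cdot>\<^sub>m B)) $$ (i, j) = (c \<cdot>\<^sub>m (A * B)) $$ (i, j)"
    by (simp only: index_mult_mat_sum[OF A B ij] index_mult_mat_sum[OF A smult_carrier_mat[OF B] ij])
qed (use A B in auto)

lemma smult_mult_quat:
  fixes c :: quat
  assumes A: "A \<in> carrier_mat m n" and B: "B \<in> carrier_mat n p"
  shows "(c \<cdot>\<^sub>m A) * B = c \<cdot>\<^sub>m (A * B)"
proof (rule eq_matI)
  fix i j assume "i < dim_row (c \<cdot>\<^sub>m (A * B))" "j < dim_col (c \<cdot>\<^sub>m (A * B))"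
  then have ij: "i < m" "j < p" using A B by auto
  have "(\<Sum>k<n. (c \<cdot>\<^sub>m A) $$ (i, k) * B $$ (k, j)) = c * (\<Sum>k<n. A $$ (i, k) * B $$ (k, j))"
    using A ij by (simp add: sum_distrib_left mult.assoc)
  moreover have "(c \<cdot>\<^sub>m (A * B)) $$ (i, j) = c * (A * B) $$ (i, j)" using A B ij by simp
  ultimately show "((c \<cdot>\<^sub>m A) * B) $$ (i, j) = (c \<cdot>\<^sub>m (A * B)) $$ (i, j)"
    by (simp only: index_mult_mat_sum[OF A B ij] index_mult_mat_sum[OF smult_carrier_mat[OF A] B ij])
qed (use A B in auto)

lemma qadj_smult_real:
  assumes c: "qreal c"
  shows "qadj (c \<cdot>\<^sub>m A) = c \<cdot>\<^sub>m qadj A"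
  by (rule eq_matI) (use c qreal_commute[OF c] in \<open>auto simp: qreal_def\<close>)

text \<open>Each diagonal entry of the product is the sum of the squared norms of the entries of a
  column.\<close>

lemma qadj_mult_self_eq_0:
  assumes A: "A \<in> carrier_mat m n" and z: "qadj A * A = 0\<^sub>m n n"
  shows "A = 0\<^sub>m m n"
proof (rule eq_matI)
  fix i j assume "i < dim_row (0\<^sub>m m n)" "j < dim_col (0\<^sub>m m n)"
  then have i: "i < m" and j: "j < n" by auto
  have "0 = (qadj A * A) $$ (j, j)" using z j by simp
  also have "\<dots> = (\<Sum>k<m. qcnj (A $$ (k, j)) * A $$ (k, j))"
    using A j by (subst index_mult_mat_sum[of _ n m _ n]) auto
  finally have "(\<Sum>k<m. qre (qcnj (A $$ (k, j)) * A $$ (k, j))) = 0"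
    using qre_sum[of "\<lambda>k. qcnj (A $$ (k, j)) * A $$ (k, j)" "{..<m}"] by simp
  then have "qre (qcnj (A $$ (i, j)) * A $$ (i, j)) = 0"
    using i by (subst (asm) sum_nonneg_eq_0_iff) (auto simp: qre_qcnj_mult_nonneg)
  then show "A $$ (i, j) = 0\<^sub>m m n $$ (i, j)" using i j by (simp add: qre_qcnj_mult_eq_0_iff)
qed (use A in auto)

text \<open>Multiplying the hypothesis by \<open>qadj Y\<close> from the left gives
  \<open>qadj (A * Y) * (A * Y) = 0\<close>, and positivity applies.\<close>

lemma qadj_mult_cancel:
  assumes A: "A \<in> carrier_mat m n" and Y: "Y \<in> carrier_mat n p" and z: "qadj A * (A * Y) = 0\<^sub>m n p"
  shows "A * Y = 0\<^sub>m m p"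
proof -
  have "qadj (A * Y) * (A * Y) = qadj Y * (qadj A * (A * Y))"
    using A Y by (simp add: qadj_mult[OF A Y] assoc_mult_mat[of _ p n _ m _ p])
  also have "\<dots> = 0\<^sub>m p p" using Y by (simp add: z)
  finally show ?thesis by (rule qadj_mult_self_eq_0[rotated]) (use A Y in auto)
qed

text \<open>Gaussian elimination over a division ring, by induction on the equations, with
  coefficients on the left of the unknowns.\<close>

lemma homogeneous_system_nontrivial:
  fixes M :: "'a \<Rightarrow> 'b \<Rightarrow> 'c::division_ring"
  assumes "finite K" "finite J" "card K < card J"
  shows "\<exists>c. (\<exists>j\<in>J. c j \<noteq> 0) \<and> (\<forall>k\<in>K. (\<Sum>j\<in>J. M k j * c j) = 0)"
  using assms
proof (induction K arbitrary: J M rule: finite_induct)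
  case empty
  then show ?case by (intro exI[of _ "\<lambda>_. 1"]) (auto simp: card_gt_0_iff)
next
  case (insert k K)
  show ?case
  proof (cases "\<forall>j\<in>J. M k j = 0")
    case True
    then show ?thesis using insert.IH[of J M] insert.prems insert.hyps by auto
  next
    case False
    then obtain j0 where j0: "j0 \<in> J" "M k j0 \<noteq> 0" by auto
    let ?J = "J - {j0}"
    have "card K < card ?J" using insert j0 by simp
    \<comment> \<open>Eliminating the unknown \<open>j0\<close> by means of equation
      \<open>k\<close> leaves one equation and one unknown fewer; \<open>c'\<close> below recovers
      \<open>j0\<close> from equation \<open>k\<close>.\<close>
    then obtain c where c: "\<exists>j\<in>?J. c j \<noteq> 0"
      "\<And>h. h \<in> K \<Longrightarrow> (\<Sum>j\<in>?J. (M h j - M h j0 * inverse (M k j0) * M k j) * c j) = 0"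
      using insert.IH[of ?J "\<lambda>h j. M h j - M h j0 * inverse (M k j0) * M k j"] insert.prems by auto
    define s where "s = (\<Sum>j\<in>?J. M k j * c j)"
    define c' where "c' j = (if j = j0 then - (inverse (M k j0) * s) else c j)" for j
    have split: "(\<Sum>j\<in>J. M h j * c' j) = - (M h j0 * inverse (M k j0) * s) + (\<Sum>j\<in>?J. M h j * c j)" for h
      using insert.prems j0 by (simp add: sum.remove[of J j0] c'_def mult.assoc)
    have "(\<Sum>j\<in>J. M h j * c' j) = 0" if "h \<in> K" for h
      using c(2)[OF that] unfolding split s_def
      by (simp add: left_diff_distrib sum_subtractf sum_distrib_left mult.assoc)
    moreover have "(\<Sum>j\<in>J. M k j * c' j) = 0"
      unfolding split using j0 by (simp add: s_def)
    moreover have "\<exists>j\<in>J. c' j \<noteq> 0" using c(1) by (auto simp: c'_def)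
    ultimately show ?thesis by blast
  qed
qed

section \<open>Rank of the conjugate transpose\<close>

lemma right_indep_cols_empty [simp]: "right_indep_cols A {}"
  by (simp add: right_indep_cols_def)

lemma right_indep_cols_mono:
  assumes "right_indep_cols A T" "S \<subseteq> T" "finite T"
  shows "right_indep_cols A S"
  unfolding right_indep_cols_def
proof (intro allI impI ballI)
  fix c j assume z: "\<forall>i<dim_row A. (\<Sum>j\<in>S. A $$ (i, j) * c j) = 0" and j: "j \<in> S"
  have "(\<Sum>j\<in>T. A $$ (i, j) * (if j \<in> S then c j else 0)) = (\<Sum>j\<in>S. A $$ (i, j) * c j)" for i
    using assms(2,3) by (intro sum.mono_neutral_cong_right) auto
  then have "\<forall>j\<in>T. (if j \<in> S then c j else 0) = 0"
    using assms(1)[unfolded right_indep_cols_def, rule_format, of "\<lambda>j. if j \<in> S then c j else 0"] z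
    by simp
  then show "c j = 0" using j assms(2) by (metis subsetD)
qed

lemma qrank_properties:
  shows "\<exists>J \<subseteq> {0..<dim_col A}. card J = qrank A \<and> right_indep_cols A J"
    and "J \<subseteq> {0..<dim_col A} \<Longrightarrow> right_indep_cols A J \<Longrightarrow> card J \<le> qrank A"
proof -
  let ?K = "{k. \<exists>J. J \<subseteq> {0..<dim_col A} \<and> card J = k \<and> right_indep_cols A J}"
  have "?K \<subseteq> card ` Pow {0..<dim_col A}" by auto
  then have fin: "finite ?K" by (rule finite_subset) simp
  have "0 \<in> ?K" by (auto intro!: exI[of _ "{}"])
  then have "Max ?K \<in> ?K" using fin by (intro Max_in) auto
  then show "\<exists>J \<subseteq> {0..<dim_col A}. card J = qrank A \<and> right_indep_cols A J"
    unfolding qrank_def by auto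
  show "card J \<le> qrank A" if "J \<subseteq> {0..<dim_col A}" "right_indep_cols A J"
    unfolding qrank_def using fin that by (intro Max_ge) auto
qed

text \<open>A maximal independent set \<open>J\<close> of columns generates all columns with
  coefficients \<open>K\<close>. Among more than \<open>card J\<close> columns of
  \<open>qadj A\<close> there is a nontrivial combination that vanishes in the rows indexed by
  \<open>J\<close>, and by means of \<open>K\<close> it vanishes in every other row too.\<close>

lemma qrank_qadj_le: "qrank (qadj A) \<le> qrank A"
proof -
  obtain J where J: "J \<subseteq> {0..<dim_col A}" "card J = qrank A" "right_indep_cols A J"
    using qrank_properties(1) by blast
  have finJ: "finite J" using J(1) by (rule finite_subset) simp
  have "\<exists>K. \<forall>i<dim_row A. A $$ (i, j) = (\<Sum>k\<in>J. A $$ (i, k) * K k)" if j: "j < dim_col A" for j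
  proof (cases "j \<in> J")
    case True
    have "(\<Sum>k\<in>J. A $$ (i, k) * (if k = j then 1 else 0)) = (\<Sum>k\<in>J. if k = j then A $$ (i, k) else 0)" for i
      by (intro sum.cong) auto
    then have "A $$ (i, j) = (\<Sum>k\<in>J. A $$ (i, k) * (if k = j then 1 else 0))" for i
      using finJ True by simp
    then show ?thesis by (intro exI[of _ "\<lambda>k. if k = j then 1 else 0"]) simp
  next
    case False
    \<comment> \<open>\<open>J\<close> has the largest possible size, so enlarging it destroys
      independence; the resulting relation must involve column \<open>j\<close>.\<close>
    have "\<not> right_indep_cols A (insert j J)"
      using qrank_properties(2)[of "insert j J" A] J False finJ j by auto
    then obtain c l where c: "\<And>i. i < dim_row A \<Longrightarrow> (\<Sum>k\<in>insert j J. A $$ (i, k) * c k) = 0"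
      and l: "l \<in> insert j J" "c l \<noteq> 0" unfolding right_indep_cols_def by blast
    have sum: "A $$ (i, j) * c j + (\<Sum>k\<in>J. A $$ (i, k) * c k) = 0" if "i < dim_row A" for i
      using c[OF that] False finJ by simp
    have cj: "c j \<noteq> 0"
    proof
      assume "c j = 0"
      then have "\<forall>k\<in>J. c k = 0" using J(3) sum unfolding right_indep_cols_def by simp
      then show False using l \<open>c j = 0\<close> by auto
    qed
    have "A $$ (i, j) = (\<Sum>k\<in>J. A $$ (i, k) * (- (c k * inverse (c j))))" if "i < dim_row A" for i
    proof -
      have "A $$ (i, j) = (A $$ (i, j) * c j) * inverse (c j)" using cj by (simp add: mult.assoc)
      also have "A $$ (i, j) * c j = - (\<Sum>k\<in>J. A $$ (i, k) * c k)"
        using sum[OF that] by (simp add: eq_neg_iff_add_eq_0)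
      finally show ?thesis by (simp add: sum_distrib_right sum_negf mult.assoc)
    qed
    then have "\<forall>i<dim_row A. A $$ (i, j) = (\<Sum>k\<in>J. A $$ (i, k) * (- (c k * inverse (c j))))"
      by (intro allI impI)
    then show ?thesis by (rule exI[of _ "\<lambda>k. - (c k * inverse (c j))"])
  qed
  then obtain K where K: "\<And>i j. i < dim_row A \<Longrightarrow> j < dim_col A \<Longrightarrow>
      A $$ (i, j) = (\<Sum>k\<in>J. A $$ (i, k) * K j k)" by metis
  obtain J' where J': "J' \<subseteq> {0..<dim_col (qadj A)}" "card J' = qrank (qadj A)" "right_indep_cols (qadj A) J'"
    using qrank_properties(1) by blast
  have finJ': "finite J'" using J'(1) by (rule finite_subset) simp
  show ?thesis
  proof (rule ccontr)
    assume "\<not> ?thesis"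
    then obtain c where c: "\<exists>i\<in>J'. c i \<noteq> 0" "\<And>k. k \<in> J \<Longrightarrow> (\<Sum>i\<in>J'. qcnj (A $$ (i, k)) * c i) = 0"
      using homogeneous_system_nontrivial[OF finJ finJ', of "\<lambda>k i. qcnj (A $$ (i, k))"] J J' by auto
    have "(\<Sum>i\<in>J'. qadj A $$ (j, i) * c i) = 0" if j: "j < dim_col A" for j
    proof -
      have "(\<Sum>i\<in>J'. qadj A $$ (j, i) * c i) = (\<Sum>i\<in>J'. \<Sum>k\<in>J. qcnj (K j k) * (qcnj (A $$ (i, k)) * c i))"
      proof (rule sum.cong[OF refl])
        fix i assume "i \<in> J'"
        then have i: "i < dim_row A" using J' by auto
        have "qadj A $$ (j, i) = qcnj (\<Sum>k\<in>J. A $$ (i, k) * K j k)" using K[OF i j] i j by simp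
        then show "qadj A $$ (j, i) * c i = (\<Sum>k\<in>J. qcnj (K j k) * (qcnj (A $$ (i, k)) * c i))"
          by (simp add: qcnj_sum sum_distrib_right mult.assoc)
      qed
      also have "\<dots> = (\<Sum>k\<in>J. \<Sum>i\<in>J'. qcnj (K j k) * (qcnj (A $$ (i, k)) * c i))"
        by (rule sum.swap)
      also have "\<dots> = (\<Sum>k\<in>J. qcnj (K j k) * (\<Sum>i\<in>J'. qcnj (A $$ (i, k)) * c i))"
        by (simp add: sum_distrib_left)
      finally show ?thesis by (simp add: c(2))
    qed
    then show False using J'(3) c(1) unfolding right_indep_cols_def by auto
  qed
qed

lemma qrank_qadj: "qrank (qadj A) = qrank A"
  using qrank_qadj_le[of A] qrank_qadj_le[of "qadj A"] by simp

text \<open>The entries of \<open>qadj A * A\<close> as a function on all pairs of naturals, the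
  form that \<open>pdet\<close> and \<open>padj\<close> expect; it is Hermitian even at indices
  beyond the matrix.\<close>

definition gram :: "quat mat \<Rightarrow> nat \<Rightarrow> nat \<Rightarrow> quat" where
  "gram A i j = (\<Sum>k<dim_row A. qcnj (A $$ (k, i)) * A $$ (k, j))"

lemma herm_gram: "herm (gram A)"
  by (simp add: herm_def gram_def qcnj_sum)

lemma index_qadj_mult_self:
  assumes A: "A \<in> carrier_mat m n" and ij: "i < n" "j < n"
  shows "(qadj A * A) $$ (i, j) = gram A i j"
  using assms by (subst index_mult_mat_sum[of _ n m _ n]) (auto simp: gram_def)

lemma gram_mult:
  "(\<Sum>j\<in>T. gram A l j * c j) = (\<Sum>k<dim_row A. qcnj (A $$ (k, l)) * (\<Sum>j\<in>T. A $$ (k, j) * c j))"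
  unfolding gram_def sum_distrib_right sum_distrib_left by (subst sum.swap) (simp add: mult.assoc)

text \<open>A dependence relation \<open>c\<close> is a kernel vector of the Gram matrix, and the
  adjugate turns this into the minor times \<open>c\<close> being zero.\<close>

lemma pdet_gram_dependent:
  assumes fin: "finite T" and dep: "\<not> right_indep_cols A T"
  shows "pdet (gram A) T = 0"
proof -
  obtain c j where z: "\<And>i. i < dim_row A \<Longrightarrow> (\<Sum>j\<in>T. A $$ (i, j) * c j) = 0" and j: "j \<in> T" "c j \<noteq> 0"
    using dep unfolding right_indep_cols_def by blast
  have "pdet (gram A) T * c j = (\<Sum>k\<in>T. if k = j then pdet (gram A) T * c k else 0)"
    using j fin by simp
  also have "\<dots> = (\<Sum>k\<in>T. (\<Sum>l\<in>T. padj (gram A) T j l * gram A l k) * c k)"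
    using padj_mult_left[OF fin herm_gram j(1)] by (intro sum.cong) auto
  also have "\<dots> = (\<Sum>k\<in>T. \<Sum>l\<in>T. padj (gram A) T j l * (gram A l k * c k))"
    by (simp add: sum_distrib_right mult.assoc)
  also have "\<dots> = (\<Sum>l\<in>T. padj (gram A) T j l * (\<Sum>k\<in>T. gram A l k * c k))"
    unfolding sum_distrib_left by (rule sum.swap)
  also have "\<dots> = 0" by (simp add: gram_mult z)
  finally show ?thesis using j by simp
qed

text \<open>Let \<open>y\<close> be column \<open>i\<close> of the adjugate on
  \<open>insert i S\<close>. By Cramer's rule the squared norm of \<open>A\<close> applied to
  \<open>y\<close> is the product of the minors of \<open>S\<close> and \<open>insert i S\<close>.
  The former is positive by induction and equals \<open>y i\<close>, so independence makes the norm
  positive.\<close>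

lemma pdet_gram_pos:
  assumes "finite T" "right_indep_cols A T"
  shows "qre (pdet (gram A) T) > 0"
  using assms
proof (induction T rule: finite_induct)
  case (insert i S)
  let ?T = "insert i S" and ?f = "gram A"
  have fin: "finite ?T" using insert by simp
  have S: "qre (pdet ?f S) > 0"
    using insert right_indep_cols_mono[of A ?T S] by auto
  define y where "y l = padj ?f ?T l i" for l
  have yi: "y i = pdet ?f S" using padj_same[of ?T i ?f] insert by (simp add: y_def)
  define v where "v k = (\<Sum>l\<in>?T. A $$ (k, l) * y l)" for k
  have "(\<Sum>k<dim_row A. qcnj (v k) * v k) = (\<Sum>l\<in>?T. qcnj (y l) * (\<Sum>k<dim_row A. qcnj (A $$ (k, l)) * v k))"
    by (subst (1) v_def) (simp add: qcnj_sum sum_distrib_right sum_distrib_left mult.assoc sum.swap[of _ ?T] del: sum.insert)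
  also have "\<dots> = (\<Sum>l\<in>?T. qcnj (y l) * (\<Sum>j\<in>?T. ?f l j * y j))"
    by (simp add: gram_mult v_def del: sum.insert)
  also have "\<dots> = (\<Sum>l\<in>?T. if l = i then qcnj (y l) * pdet ?f ?T else 0)"
    using padj_mult_right[OF fin herm_gram] unfolding y_def by (intro sum.cong) auto
  also have "\<dots> = pdet ?f S * pdet ?f ?T"
    using fin yi pdet_real[OF insert.hyps(1) herm_gram, of A] by (simp add: qreal_def del: sum.insert)
  finally have eq: "(\<Sum>k<dim_row A. qcnj (v k) * v k) = pdet ?f S * pdet ?f ?T" .
  have "y i \<noteq> 0" using S yi by auto
  then have "\<exists>k<dim_row A. v k \<noteq> 0"
    using insert.prems unfolding right_indep_cols_def v_def by blast
  then obtain k where k: "k < dim_row A" "v k \<noteq> 0" by blast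
  have "0 < qre (qcnj (v k) * v k)"
    using k qre_qcnj_mult_nonneg[of "v k"] qre_qcnj_mult_eq_0_iff[of "v k"] by linarith
  then have "0 < (\<Sum>k<dim_row A. qre (qcnj (v k) * v k))"
    using k by (intro sum_pos2[of _ k]) (auto simp: qre_qcnj_mult_nonneg)
  also have "\<dots> = qre (pdet ?f S) * qre (pdet ?f ?T)"
    unfolding qre_sum[symmetric] eq using pdet_real[OF insert.hyps(1) herm_gram, of A]
    by (simp add: quat_times_sel(1) qreal_iff)
  finally show ?case using S by (simp add: zero_less_mult_iff)
qed simp

section \<open>Minors and adjugates summed over all index sets of a given size\<close>

definition pdet_sum :: "quat mat \<Rightarrow> nat \<Rightarrow> quat" where
  "pdet_sum A k = (\<Sum>S\<in>Lset k (dim_col A). pdet (gram A) S)"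

text \<open>With \<open>F = qadj A * A\<close> and \<open>n\<close> columns, this is the coefficient
  of \<open>t^(n-k)\<close> in the adjugate of \<open>F + t I\<close>. As \<open>padj\<close>
  vanishes outside its index set, the adjugates of different submatrices add up as full-size
  matrices.\<close>

definition padj_sum :: "quat mat \<Rightarrow> nat \<Rightarrow> quat mat" where
  "padj_sum A k = mat (dim_col A) (dim_col A) (\<lambda>(i, j). \<Sum>S\<in>Lset k (dim_col A). padj (gram A) S i j)"

lemma finite_Lset [simp]: "finite (Lset k n)"
  by (simp add: Lset_def)

lemma Lset_finite: "S \<in> Lset k n \<Longrightarrow> finite S"
  by (auto simp: Lset_def intro: finite_subset)

lemma Lset_subset: "S \<in> Lset k n \<Longrightarrow> S \<subseteq> {..<n}"
  by (auto simp: Lset_def)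

lemma pdet_sum_real: "qreal (pdet_sum A k)"
  unfolding pdet_sum_def by (intro qreal_sum pdet_real herm_gram) (rule Lset_finite)

lemma pdet_sum_eq_0:
  assumes "k > qrank A"
  shows "pdet_sum A k = 0"
  unfolding pdet_sum_def
proof (rule sum.neutral, rule ballI)
  fix S assume S: "S \<in> Lset k (dim_col A)"
  then have "\<not> right_indep_cols A S"
    using assms qrank_properties(2)[of S A] by (auto simp: Lset_def)
  then show "pdet (gram A) S = 0" using Lset_finite[OF S] by (intro pdet_gram_dependent)
qed

text \<open>No principal minor of a Gram matrix is negative, and an independent set of maximal size
  contributes a positive one.\<close>

lemma pdet_sum_rank_nonzero: "pdet_sum A (qrank A) \<noteq> 0"
proof -
  obtain J where J: "J \<subseteq> {0..<dim_col A}" "card J = qrank A" "right_indep_cols A J"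
    using qrank_properties(1) by blast
  then have JL: "J \<in> Lset (qrank A) (dim_col A)" by (simp add: Lset_def)
  have "qre (pdet (gram A) S) \<ge> 0" if "S \<in> Lset (qrank A) (dim_col A)" for S
    using pdet_gram_pos[of S A] pdet_gram_dependent[of S A] Lset_finite[OF that]
    by (cases "right_indep_cols A S") auto
  then have "qre (pdet_sum A (qrank A)) > 0"
    unfolding pdet_sum_def qre_sum
    using JL pdet_gram_pos[OF Lset_finite[OF JL] J(3)] by (intro sum_pos2[of _ J]) auto
  then show ?thesis by auto
qed

lemma padj_sum_carrier [simp]: "A \<in> carrier_mat m n \<Longrightarrow> padj_sum A k \<in> carrier_mat n n"
  by (simp add: padj_sum_def)

lemma qadj_padj_sum: "qadj (padj_sum A k) = padj_sum A k"
  by (rule eq_matI)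
    (auto simp: padj_sum_def qcnj_sum intro!: sum.cong padj_hermitian herm_gram Lset_finite)

text \<open>Cramer's rule for \<open>A\<^sup>* A + t I\<close>, read off coefficientwise in \<open>t\<close>.\<close>
lemma padj_sum_rec:
  assumes A: "A \<in> carrier_mat m n"
  shows "qadj A * A * padj_sum A k + padj_sum A (Suc k) = pdet_sum A k \<cdot>\<^sub>m 1\<^sub>m n"
proof (rule eq_matI)
  fix i j assume "i < dim_row (pdet_sum A k \<cdot>\<^sub>m 1\<^sub>m n)" "j < dim_col (pdet_sum A k \<cdot>\<^sub>m 1\<^sub>m n)"
  then have ij: "i < n" "j < n" by auto
  let ?f = "gram A"
  have F: "qadj A * A \<in> carrier_mat n n" using A by (intro mult_carrier_mat[of _ n m]) auto
  let ?L = "Lset k n"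
  \<comment> \<open>Contribution to row \<open>i\<close> of the next sum: the sets of size
    \<open>Suc k\<close> containing \<open>i\<close> are the sets \<open>insert i S\<close> with
    \<open>i\<close> outside \<open>S\<close>.\<close>
  define g where "g S = (if i \<in> S then 0 else padj ?f (insert i S) i j)" for S
  have "(\<Sum>S\<in>Lset (Suc k) n. padj ?f S i j) = (\<Sum>S\<in>{S \<in> Lset (Suc k) n. i \<in> S}. padj ?f S i j)"
    by (rule sum.mono_neutral_right) (auto simp: padj_outside)
  also have "\<dots> = (\<Sum>S\<in>{S \<in> ?L. i \<notin> S}. padj ?f (insert i S) i j)"
  proof (rule sum.reindex_bij_witness[of _ "insert i" "\<lambda>S. S - {i}"])
    fix S assume "S \<in> {S \<in> ?L. i \<notin> S}"
    then show "insert i S \<in> {S \<in> Lset (Suc k) n. i \<in> S}"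
      using ij Lset_finite[of S k n] by (auto simp: Lset_def)
  qed (auto simp: Lset_def insert_absorb)
  also have "\<dots> = (\<Sum>S\<in>?L. g S)"
    by (rule sum.mono_neutral_cong_left) (auto simp: g_def)
  finally have 1: "(\<Sum>S\<in>Lset (Suc k) n. padj ?f S i j) = (\<Sum>S\<in>?L. g S)" .
  \<comment> \<open>For each \<open>S\<close> separately: if \<open>i \<in> S\<close> this is
    Cramer's rule, and otherwise the recursion of \<open>padj\<close> on \<open>insert i S\<close>
    supplies the second term.\<close>
  have 2: "(\<Sum>l<n. ?f i l * padj ?f S l j) + g S = (if i = j then pdet ?f S else 0)" if S: "S \<in> ?L" for S
  proof -
    have fin: "finite S" using S by (rule Lset_finite)
    have "(\<Sum>l<n. ?f i l * padj ?f S l j) = (\<Sum>l\<in>S. ?f i l * padj ?f S l j)"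
      using Lset_subset[OF S] by (intro sum.mono_neutral_right) (auto simp: padj_outside)
    moreover have "(\<Sum>l\<in>S. ?f i l * padj ?f S l j) + g S = (if i = j then pdet ?f S else 0)"
    proof (cases "i \<in> S")
      case True
      then show ?thesis
        by (cases "j \<in> S") (auto simp: g_def padj_outside padj_mult_right[OF fin herm_gram])
    next
      case False
      then show ?thesis
        by (cases "i = j"; cases "j \<in> S")
          (auto simp: g_def fin padj_outside padj_same padj_neq)
    qed
    ultimately show ?thesis by simp
  qed
  have "(qadj A * A * padj_sum A k) $$ (i, j) = (\<Sum>l<n. ?f i l * (\<Sum>S\<in>?L. padj ?f S l j))"
    using A ij index_qadj_mult_self[OF A ij(1)]
    by (subst index_mult_mat_sum[OF F padj_sum_carrier[OF A] ij]) (auto simp: padj_sum_def)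
  also have "\<dots> = (\<Sum>S\<in>?L. \<Sum>l<n. ?f i l * padj ?f S l j)"
    unfolding sum_distrib_left by (rule sum.swap)
  finally have "(qadj A * A * padj_sum A k) $$ (i, j) + padj_sum A (Suc k) $$ (i, j)
      = (\<Sum>S\<in>?L. (\<Sum>l<n. ?f i l * padj ?f S l j) + g S)"
    using A ij 1 by (simp add: padj_sum_def sum.distrib)
  also have "\<dots> = (\<Sum>S\<in>?L. if i = j then pdet ?f S else 0)" by (intro sum.cong refl 2)
  also have "\<dots> = (pdet_sum A k \<cdot>\<^sub>m 1\<^sub>m n) $$ (i, j)"
    using A ij by (auto simp: pdet_sum_def)
  finally show "(qadj A * A * padj_sum A k + padj_sum A (Suc k)) $$ (i, j) = (pdet_sum A k \<cdot>\<^sub>m 1\<^sub>m n) $$ (i, j)"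
    by (subst index_add_mat(1)) (use A ij in \<open>auto simp: padj_sum_def\<close>)
qed (use A in \<open>auto simp: padj_sum_def\<close>)

text \<open>The recursion exhibits the product as a real multiple of the identity minus a Hermitian
  matrix. Being Hermitian, it equals its conjugate transpose, which is the product in the other
  order.\<close>

lemma padj_sum_commute:
  assumes A: "A \<in> carrier_mat m n"
  shows "padj_sum A k * (qadj A * A) = qadj A * A * padj_sum A k"
proof -
  let ?F = "qadj A * A"
  have F: "?F \<in> carrier_mat n n" using A by (intro mult_carrier_mat[of _ n m]) auto
  note P = padj_sum_carrier[OF A]
  have FP: "(?F * padj_sum A k) $$ (i, j) = (if i = j then pdet_sum A k else 0) - padj_sum A (Suc k) $$ (i, j)"
    if ij: "i < n" "j < n" for i j
  proof -
    have "(?F * padj_sum A k + padj_sum A (Suc k)) $$ (i, j) = (if i = j then pdet_sum A k else 0)"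
      unfolding padj_sum_rec[OF A] using ij by auto
    moreover have "(?F * padj_sum A k + padj_sum A (Suc k)) $$ (i, j)
        = (?F * padj_sum A k) $$ (i, j) + padj_sum A (Suc k) $$ (i, j)"
      by (rule index_add_mat(1)) (use ij A in \<open>auto simp: padj_sum_def\<close>)
    ultimately show ?thesis by (simp add: algebra_simps)
  qed
  have FPc: "?F * padj_sum A k \<in> carrier_mat n n" using F P by (rule mult_carrier_mat)
  have "qadj (?F * padj_sum A k) = ?F * padj_sum A k"
  proof (rule eq_matI)
    fix i j assume "i < dim_row (?F * padj_sum A k)" "j < dim_col (?F * padj_sum A k)"
    then have ij: "i < n" "j < n" using FPc by auto
    have "qcnj (padj_sum A (Suc k) $$ (j, i)) = padj_sum A (Suc k) $$ (i, j)"
      using index_qadj[of i "padj_sum A (Suc k)" j] P[of "Suc k"] ij by (simp add: qadj_padj_sum)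
    moreover have "qadj (?F * padj_sum A k) $$ (i, j) = qcnj ((?F * padj_sum A k) $$ (j, i))"
      using FPc ij by (intro index_qadj) auto
    ultimately show "qadj (?F * padj_sum A k) $$ (i, j) = (?F * padj_sum A k) $$ (i, j)"
      using pdet_sum_real[of A k] by (simp only: FP ij) (auto simp: qreal_def)
  qed (use FPc in \<open>auto simp: padj_sum_def\<close>)
  moreover have "qadj (?F * padj_sum A k) = padj_sum A k * ?F"
    using A by (simp add: qadj_mult[OF F P] qadj_mult[of _ n m _ n] qadj_padj_sum)
  ultimately show ?thesis by simp
qed

lemma Lset_eq_empty:
  assumes "k > n"
  shows "Lset k n = {}"
proof -
  have "S \<notin> Lset k n" for S
    using card_mono[OF finite_atLeastLessThan[of 0 n], of S] assms by (auto simp: Lset_def)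
  then show ?thesis by blast
qed

lemma padj_sum_eq_0: "A \<in> carrier_mat m n \<Longrightarrow> k > n \<Longrightarrow> padj_sum A k = 0\<^sub>m n n"
  by (intro eq_matI) (auto simp: padj_sum_def Lset_eq_empty)

text \<open>Cancellation of the outer factors \<open>A\<^sup>*\<close> propagates the vanishing downwards from \<open>k > n\<close>,
  where the sum is empty, as long as \<open>pdet_sum A k\<close> vanishes.\<close>
lemma padj_sum_mult_qadj_eq_0:
  assumes A: "A \<in> carrier_mat m n" and k: "k > qrank A"
  shows "padj_sum A k * qadj A = 0\<^sub>m n m"
proof (cases "k \<le> Suc n")
  case True
  let ?F = "qadj A * A"
  have F: "?F \<in> carrier_mat n n" using A by (intro mult_carrier_mat[of _ n m]) auto
  have A': "qadj A \<in> carrier_mat n m" using A by simp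
  from True k show ?thesis
  proof (induction k rule: inc_induct)
    \<comment> \<open>Here \<open>k = Suc n\<close>, beyond the size of any index set.\<close>
    case base
    then show ?case using A by (simp add: padj_sum_eq_0)
  next
    case (step k)
    define P where "P = padj_sum A k"
    have P: "P \<in> carrier_mat n n" using A by (simp add: P_def)
    have c: "P * qadj A \<in> carrier_mat n m" "A * P \<in> carrier_mat m n" "?F * P \<in> carrier_mat n n"
      using P A A' F mult_carrier_mat by blast+
    have "(?F * P + padj_sum A (Suc k)) * qadj A = 0\<^sub>m n m"
      using pdet_sum_eq_0[of A k] step.prems A unfolding P_def padj_sum_rec[OF A]
      by (intro eq_matI) (auto simp: scalar_prod_def)
    then have "?F * P * qadj A + padj_sum A (Suc k) * qadj A = 0\<^sub>m n m"
      using A by (simp add: add_mult_distrib_mat[OF c(3) padj_sum_carrier[OF A] A'])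
    then have "?F * P * qadj A = 0\<^sub>m n m"
      using step by (simp add: right_add_zero_mat[OF mult_carrier_mat[OF c(3) A']])
    then have "qadj A * (A * (P * qadj A)) = 0\<^sub>m n m"
      by (simp add: assoc_mult_mat[OF A' A c(1)] assoc_mult_mat[OF F P A'])
    then have "A * (P * qadj A) = 0\<^sub>m m m"
      by (rule qadj_mult_cancel[OF A c(1)])
    \<comment> \<open>Commuting \<open>P\<close> with the Gram matrix moves the remaining factor to
      the left, where cancellation applies twice more.\<close>
    then have "A * (P * qadj A) * A = 0\<^sub>m m n" using A by simp
    moreover have "A * (P * qadj A) * A = A * (P * ?F)"
      by (simp add: assoc_mult_mat[OF A c(1) A] assoc_mult_mat[OF P A' A])
    moreover have "P * ?F = qadj A * (A * P)"
      unfolding P_def padj_sum_commute[OF A] by (rule assoc_mult_mat[OF A' A padj_sum_carrier[OF A]])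
    ultimately have "qadj (qadj A) * (qadj A * (A * P)) = 0\<^sub>m m n" by simp
    then have "qadj A * (A * P) = 0\<^sub>m n n"
      by (rule qadj_mult_cancel[OF A' c(2)])
    then have "A * P = 0\<^sub>m m n" by (rule qadj_mult_cancel[OF A P])
    then have "qadj (A * P) = 0\<^sub>m n m" by simp
    then show ?case unfolding qadj_mult[OF A P] by (simp add: P_def qadj_padj_sum)
  qed
next
  case False
  then show ?thesis using A by (simp add: padj_sum_eq_0)
qed

subsection \<open>The Moore--Penrose inverse\<close>

definition is_mp_inv :: "quat mat \<Rightarrow> quat mat \<Rightarrow> bool" where
  "is_mp_inv A X \<longleftrightarrow> X \<in> carrier_mat (dim_col A) (dim_row A) \<and>
      A * X * A = A \<and> X * A * X = X \<and> qadj (A * X) = A * X \<and> qadj (X * A) = X * A"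

text \<open>\<open>A * X\<close> and \<open>A * Y\<close> absorb each other, so being Hermitian they
  coincide; the same holds for \<open>X * A\<close> and \<open>Y * A\<close>.\<close>

lemma is_mp_inv_unique:
  assumes "is_mp_inv A X" "is_mp_inv A Y"
  shows "X = Y"
proof -
  obtain m n where A: "A \<in> carrier_mat m n" by auto
  have X: "X \<in> carrier_mat n m" and Y: "Y \<in> carrier_mat n m"
    using assms A by (auto simp: is_mp_inv_def)
  note x = assms(1)[unfolded is_mp_inv_def] and y = assms(2)[unfolded is_mp_inv_def]
  have AX: "A * X \<in> carrier_mat m m" and AY: "A * Y \<in> carrier_mat m m"
    and XA: "X * A \<in> carrier_mat n n" and YA: "Y * A \<in> carrier_mat n n"
    using A X Y mult_carrier_mat by blast+
  have "A * X = (A * Y) * (A * X)"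
    using y by (simp add: assoc_mult_mat[OF AY A X, symmetric])
  then have "qadj (A * X) = qadj ((A * Y) * (A * X))" by simp
  then have "A * X = (A * X) * (A * Y)" using x y by (simp add: qadj_mult[OF AY AX])
  also have "\<dots> = A * Y" using x by (simp add: assoc_mult_mat[OF AX A Y, symmetric])
  finally have 1: "A * X = A * Y" .
  have "X * A = (X * A) * (Y * A)"
    using y by (simp add: assoc_mult_mat[OF X A YA] assoc_mult_mat[OF A Y A, symmetric])
  then have "qadj (X * A) = qadj ((X * A) * (Y * A))" by simp
  then have "X * A = (Y * A) * (X * A)" using x y by (simp add: qadj_mult[OF XA YA])
  also have "\<dots> = Y * A"
    using x by (simp add: assoc_mult_mat[OF Y A XA] assoc_mult_mat[OF A X A, symmetric])
  finally have 2: "X * A = Y * A" .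
  have "X = X * A * X" using x by simp
  also have "\<dots> = Y * (A * Y)" using 1 2 by (simp add: assoc_mult_mat[OF Y A X])
  also have "\<dots> = Y" using y by (simp add: assoc_mult_mat[OF Y A Y])
  finally show ?thesis .
qed

lemma mp_inv_eqI: "is_mp_inv A X \<Longrightarrow> mp_inv A = X"
  unfolding mp_inv_def is_mp_inv_def[symmetric]
  by (intro the_equality) (auto dest: is_mp_inv_unique)

text \<open>The recursion at the rank, multiplied by \<open>qadj A\<close> on the right, loses its
  second term. Dividing by the nonzero real sum of minors yields
  \<open>qadj A * (A * X) = qadj A\<close> for the candidate \<open>X\<close>.\<close>

lemma is_mp_inv_padj_sum:
  assumes A: "A \<in> carrier_mat m n"
  shows "is_mp_inv A (inverse (pdet_sum A (qrank A)) \<cdot>\<^sub>m (padj_sum A (qrank A) * qadj A))"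
proof -
  define P where "P = padj_sum A (qrank A)"
  define d where "d = pdet_sum A (qrank A)"
  define c where "c = inverse d"
  let ?F = "qadj A * A"
  define X where "X = c \<cdot>\<^sub>m (P * qadj A)"
  have A': "qadj A \<in> carrier_mat n m" and P: "P \<in> carrier_mat n n" using A by (auto simp: P_def)
  have F: "?F \<in> carrier_mat n n" using A' A by (rule mult_carrier_mat)
  have PA: "P * qadj A \<in> carrier_mat n m" using P A' by (rule mult_carrier_mat)
  have X: "X \<in> carrier_mat n m" using PA by (simp add: X_def)
  have FP: "?F * P \<in> carrier_mat n n" using F P by (rule mult_carrier_mat)
  have d: "qreal d" "d \<noteq> 0" by (simp_all add: d_def pdet_sum_real pdet_sum_rank_nonzero)
  have cr: "qreal c" using d(1) unfolding c_def by (rule qreal_inverse)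
  have adj_F: "qadj ?F = ?F" by (simp add: qadj_mult[OF A' A])
  have adj_P: "qadj P = P" by (simp add: P_def qadj_padj_sum)
  have comm: "P * ?F = ?F * P" unfolding P_def by (rule padj_sum_commute[OF A])
  have "(?F * P + padj_sum A (Suc (qrank A))) * qadj A = d \<cdot>\<^sub>m qadj A"
    unfolding P_def padj_sum_rec[OF A] d_def using smult_mult_quat[OF one_carrier_mat A']
    by (simp add: left_mult_one_mat[OF A'])
  then have FPA: "?F * P * qadj A = d \<cdot>\<^sub>m qadj A"
    using padj_sum_mult_qadj_eq_0[OF A, of "Suc (qrank A)"]
    by (simp add: add_mult_distrib_mat[OF FP padj_sum_carrier[OF A] A'] right_add_zero_mat[OF mult_carrier_mat[OF FP A']])
  have cd: "c \<cdot>\<^sub>m (d \<cdot>\<^sub>m qadj A) = qadj A"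
    using d by (intro eq_matI) (auto simp: c_def simp flip: mult.assoc)
  have XA: "X * A = c \<cdot>\<^sub>m (P * ?F)"
    unfolding X_def by (simp add: smult_mult_quat[OF PA A] assoc_mult_mat[OF P A' A])
  have AX: "A * X = c \<cdot>\<^sub>m (A * (P * qadj A))"
    unfolding X_def by (rule mult_smult_real[OF A PA cr])
  have "qadj (P * ?F) = qadj ?F * qadj P" by (rule qadj_mult[OF P F])
  also have "\<dots> = P * ?F" unfolding adj_F adj_P by (rule comm[symmetric])
  finally have hXA: "qadj (X * A) = X * A" unfolding XA by (simp only: qadj_smult_real[OF cr])
  have hAX: "qadj (A * X) = A * X"
    unfolding AX by (simp add: qadj_smult_real[OF cr] qadj_mult[OF A PA] qadj_mult[OF P A'] adj_P
        assoc_mult_mat[OF A P A'])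
  have AXc: "A * X \<in> carrier_mat m m" using A X by (rule mult_carrier_mat)
  have "qadj A * (A * X) = c \<cdot>\<^sub>m (?F * (P * qadj A))"
    unfolding AX using A' A PA
    by (simp add: mult_smult_real[OF A' mult_carrier_mat[OF A PA] cr] assoc_mult_mat[OF A' A PA])
  also have "\<dots> = qadj A" using FPA cd by (simp add: assoc_mult_mat[OF F P A'])
  finally have *: "qadj A * (A * X) = qadj A" .
  \<comment> \<open>As \<open>A * X\<close> is Hermitian, the first Penrose equation is the adjoint
    of the identity just obtained.\<close>
  have "A * X * A = qadj (qadj A * (A * X))" by (simp add: qadj_mult[OF A' AXc] hAX)
  then have AXA: "A * X * A = A" by (simp add: *)
  have "X * A * X = X * (A * X)" by (rule assoc_mult_mat[OF X A X])
  also have "\<dots> = c \<cdot>\<^sub>m (P * qadj A * (A * X))"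
    by (rule smult_mult_quat[OF PA AXc, of c, folded X_def])
  also have "\<dots> = c \<cdot>\<^sub>m (P * (qadj A * (A * X)))" by (simp only: assoc_mult_mat[OF P A' AXc])
  also have "\<dots> = X" unfolding * by (rule X_def[symmetric])
  finally have XAX: "X * A * X = X" .
  show ?thesis
    unfolding is_mp_inv_def using X A hXA hAX AXA XAX by (simp add: X_def c_def d_def P_def)
qed

text \<open>\<open>hdet\<close> is reached through its conjugate \<open>ddet\<close>; the matrix is
  self-adjoint and the minor real, so neither conjugation changes the value.\<close>

lemma hdet_qadj_mult_self:
  assumes A: "A \<in> carrier_mat m n" and T: "T \<subseteq> {..<n}"
  shows "hdet T (qadj A * A) = pdet (gram A) T"
proof -
  have F: "qadj A * A \<in> carrier_mat n n" using A by (intro mult_carrier_mat[of _ n m]) auto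
  have fin: "finite T" using T by (rule finite_subset) simp
  have "qcnj (hdet T (qadj A * A)) = ddet T (qadj A * A)"
    using qcnj_hdet[OF F T] A by (simp add: qadj_mult[of _ n m])
  also have "\<dots> = pdet (gram A) T"
    by (rule wcdet_eq_padj(1)[OF fin herm_gram]) (use T index_qadj_mult_self[OF A] in auto)
  finally have "qcnj (qcnj (hdet T (qadj A * A))) = qcnj (pdet (gram A) T)" by simp
  then show ?thesis using pdet_real[OF fin herm_gram, of A] by (simp add: qreal_def)
qed

lemma cdet_qadj_mult_self:
  assumes A: "A \<in> carrier_mat m n" and T: "T \<subseteq> {..<n}" and i: "i \<in> T"
  shows "cdet T i (col_repl (qadj A * A) i b) = (\<Sum>j\<in>T. padj (gram A) T i j * b $ j)"
proof -
  have F: "qadj A * A \<in> carrier_mat n n" using A by (intro mult_carrier_mat[of _ n m]) auto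
  have fin: "finite T" using T by (rule finite_subset) simp
  have "cdet T i (col_repl (qadj A * A) i b) = 1 * (\<Sum>j\<in>T. padj (gram A) T i j * b $ j)"
    unfolding cdet_col_repl[OF F T i]
    by (rule wcdet_eq_padj(2)[OF fin herm_gram _ i]) (use T index_qadj_mult_self[OF A] in auto)
  then show ?thesis by simp
qed

lemma sum_hdet_qadj_mult_self:
  assumes A: "A \<in> carrier_mat m n"
  shows "(\<Sum>\<beta>\<in>Lset k n. hdet \<beta> (qadj A * A)) = pdet_sum A k"
  using A hdet_qadj_mult_self[OF A Lset_subset] by (simp add: pdet_sum_def)

text \<open>The adjugate form of \<open>cdet\<close>, summed over the index sets, is an entry of
  \<open>padj_sum\<close> times \<open>qadj A * C\<close>, which is the adjugate formula for the
  inverse with its denominator cleared.\<close>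

lemma mp_inv_mult_cdet:
  assumes A: "A \<in> carrier_mat m n" and C: "C \<in> carrier_mat m s" and ij: "i < n" "j < s"
  shows "(mp_inv A * C) $$ (i, j) =
    (\<Sum>\<beta>\<in>{\<beta> \<in> Lset (qrank A) n. i \<in> \<beta>}. cdet \<beta> i (col_repl (qadj A * A) i (col (qadj A * C) j)))
    / (\<Sum>\<beta>\<in>Lset (qrank A) n. hdet \<beta> (qadj A * A))"
proof -
  define r where "r = qrank A"
  define d where "d = pdet_sum A r"
  have A': "qadj A \<in> carrier_mat n m" using A by simp
  have P: "padj_sum A r \<in> carrier_mat n n" using A by simp
  have AC: "qadj A * C \<in> carrier_mat n s" using A' C by (rule mult_carrier_mat)
  have PA: "padj_sum A r * qadj A \<in> carrier_mat n m" using P A' by (rule mult_carrier_mat)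
  have "(\<Sum>\<beta>\<in>{\<beta> \<in> Lset r n. i \<in> \<beta>}. cdet \<beta> i (col_repl (qadj A * A) i (col (qadj A * C) j)))
      = (\<Sum>\<beta>\<in>{\<beta> \<in> Lset r n. i \<in> \<beta>}. \<Sum>l<n. padj (gram A) \<beta> i l * (qadj A * C) $$ (l, j))"
  proof (rule sum.cong[OF refl])
    fix \<beta> assume "\<beta> \<in> {\<beta> \<in> Lset r n. i \<in> \<beta>}"
    then have \<beta>: "\<beta> \<subseteq> {..<n}" "i \<in> \<beta>" using Lset_subset by auto
    have "cdet \<beta> i (col_repl (qadj A * A) i (col (qadj A * C) j))
        = (\<Sum>l\<in>\<beta>. padj (gram A) \<beta> i l * (qadj A * C) $$ (l, j))"
      unfolding cdet_qadj_mult_self[OF A \<beta>]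
    proof (rule sum.cong[OF refl])
      fix l assume "l \<in> \<beta>"
      then have "l < n" using \<beta> by auto
      then have "col (qadj A * C) j $ l = (qadj A * C) $$ (l, j)"
        using A C ij by (intro index_col) auto
      then show "padj (gram A) \<beta> i l * col (qadj A * C) j $ l = padj (gram A) \<beta> i l * (qadj A * C) $$ (l, j)"
        by simp
    qed
    also have "\<dots> = (\<Sum>l<n. padj (gram A) \<beta> i l * (qadj A * C) $$ (l, j))"
      using \<beta> by (intro sum.mono_neutral_left) (auto simp: padj_outside)
    finally show "cdet \<beta> i (col_repl (qadj A * A) i (col (qadj A * C) j))
        = (\<Sum>l<n. padj (gram A) \<beta> i l * (qadj A * C) $$ (l, j))" .
  qed
  \<comment> \<open>Index sets without \<open>i\<close> may be added, as their adjugates vanish at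
    \<open>i\<close>.\<close>
  also have "\<dots> = (\<Sum>\<beta>\<in>Lset r n. \<Sum>l<n. padj (gram A) \<beta> i l * (qadj A * C) $$ (l, j))"
    by (rule sum.mono_neutral_left) (auto simp: padj_outside)
  also have "\<dots> = (\<Sum>l<n. \<Sum>\<beta>\<in>Lset r n. padj (gram A) \<beta> i l * (qadj A * C) $$ (l, j))"
    by (rule sum.swap)
  also have "\<dots> = (\<Sum>l<n. padj_sum A r $$ (i, l) * (qadj A * C) $$ (l, j))"
    using A ij by (auto simp: padj_sum_def sum_distrib_right)
  also have "\<dots> = (padj_sum A r * (qadj A * C)) $$ (i, j)"
    by (rule index_mult_mat_sum[OF P AC ij, symmetric])
  finally have num: "(\<Sum>\<beta>\<in>{\<beta> \<in> Lset r n. i \<in> \<beta>}. cdet \<beta> i (col_repl (qadj A * A) i (col (qadj A * C) j)))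
      = (padj_sum A r * (qadj A * C)) $$ (i, j)" .
  have "mp_inv A = inverse d \<cdot>\<^sub>m (padj_sum A r * qadj A)"
    unfolding d_def r_def by (rule mp_inv_eqI[OF is_mp_inv_padj_sum[OF A]])
  then have "mp_inv A * C = inverse d \<cdot>\<^sub>m (padj_sum A r * (qadj A * C))"
    by (simp add: smult_mult_quat[OF PA C] assoc_mult_mat[OF P A' C])
  then have "(mp_inv A * C) $$ (i, j) = inverse d * (padj_sum A r * (qadj A * C)) $$ (i, j)"
    using mult_carrier_mat[OF P AC] ij by (simp only:) (subst index_smult_mat(1), auto)
  \<comment> \<open>Division is right multiplication by the inverse; the real denominator may change
    sides.\<close>
  also have "\<dots> = (padj_sum A r * (qadj A * C)) $$ (i, j) / d"
    unfolding divide_quat_def d_def by (intro qreal_commute qreal_inverse pdet_sum_real)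
  finally show ?thesis
    unfolding r_def[symmetric] num sum_hdet_qadj_mult_self[OF A] d_def .
qed

lemma mp_inv_qadj:
  shows "mp_inv (qadj A) = qadj (mp_inv A)" and "mp_inv A \<in> carrier_mat (dim_col A) (dim_row A)"
proof -
  obtain m n where A: "A \<in> carrier_mat m n" by auto
  have mp: "is_mp_inv A (mp_inv A)"
    using is_mp_inv_padj_sum[OF A] mp_inv_eqI by metis
  then show "mp_inv A \<in> carrier_mat (dim_col A) (dim_row A)" by (simp add: is_mp_inv_def)
  then have X: "mp_inv A \<in> carrier_mat n m" using A by simp
  note x = mp[unfolded is_mp_inv_def]
  note XA = mult_carrier_mat[OF X A] and AX = mult_carrier_mat[OF A X]
  have A': "qadj A \<in> carrier_mat n m" and X': "qadj (mp_inv A) \<in> carrier_mat m n" using A X by simp_all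
  have 1: "qadj A * qadj (mp_inv A) = mp_inv A * A" "qadj (mp_inv A) * qadj A = A * mp_inv A"
    using x by (simp_all flip: qadj_mult[OF X A] qadj_mult[OF A X])
  have "mp_inv A * A * qadj A = qadj (A * (mp_inv A * A))"
    using x by (simp add: qadj_mult[OF A XA])
  also have "\<dots> = qadj A" using x by (simp flip: assoc_mult_mat[OF A X A])
  finally have 2: "mp_inv A * A * qadj A = qadj A" .
  have "A * mp_inv A * qadj (mp_inv A) = qadj (mp_inv A * (A * mp_inv A))"
    using x by (simp add: qadj_mult[OF X AX])
  also have "\<dots> = qadj (mp_inv A)" using x by (simp flip: assoc_mult_mat[OF X A X])
  finally have 3: "A * mp_inv A * qadj (mp_inv A) = qadj (mp_inv A)" .
  show "mp_inv (qadj A) = qadj (mp_inv A)"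
    by (rule mp_inv_eqI) (use x X A 1 2 3 in \<open>simp add: is_mp_inv_def\<close>)
qed

text \<open>The column formula for \<open>qadj B\<close> and \<open>qadj C\<close>, conjugated;
  \<open>qadj B\<close> has the same rank as \<open>B\<close>, so the index sets have the same
  size.\<close>

lemma mult_mp_inv_rdet:
  assumes B: "B \<in> carrier_mat q s" and C: "C \<in> carrier_mat m s" and gf: "g < m" "f < q"
  shows "(C * mp_inv B) $$ (g, f) =
    (\<Sum>\<alpha>\<in>{\<alpha> \<in> Lset (qrank B) q. f \<in> \<alpha>}. rdet \<alpha> f (row_repl (B * qadj B) f (row (C * qadj B) g)))
    / (\<Sum>\<alpha>\<in>Lset (qrank B) q. hdet \<alpha> (B * qadj B))"
proof -
  have B': "qadj B \<in> carrier_mat s q" and C': "qadj C \<in> carrier_mat s m" using B C by simp_all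
  have X: "mp_inv B \<in> carrier_mat s q" using mp_inv_qadj(2)[of B] B by simp
  have F: "B * qadj B \<in> carrier_mat q q" using B B' by (rule mult_carrier_mat)
  have CB: "C * qadj B \<in> carrier_mat m q" using C B' by (rule mult_carrier_mat)
  define d where "d = (\<Sum>\<alpha>\<in>Lset (qrank B) q. hdet \<alpha> (B * qadj B))"
  have dreal: "qreal d"
    using sum_hdet_qadj_mult_self[OF B', of "qrank B"] pdet_sum_real[of "qadj B" "qrank B"] by (simp add: d_def)
  have inv_real: "qcnj (inverse d) = inverse d"
    using qreal_inverse[OF dreal] by (simp add: qreal_def)
  define num where "num = (\<Sum>\<alpha>\<in>{\<alpha> \<in> Lset (qrank B) q. f \<in> \<alpha>}. cdet \<alpha> f (col_repl (B * qadj B) f (col (B * qadj C) g)))"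
  have "qcnj ((C * mp_inv B) $$ (g, f)) = qadj (C * mp_inv B) $$ (f, g)"
    using mult_carrier_mat[OF C X] gf by (intro index_qadj[symmetric]) auto
  also have "\<dots> = (mp_inv (qadj B) * qadj C) $$ (f, g)"
    by (simp add: qadj_mult[OF C X] mp_inv_qadj(1))
  also have "\<dots> = num / d"
    using mp_inv_mult_cdet[OF B' C' gf(2,1)] by (simp add: qrank_qadj num_def d_def)
  finally have "qcnj (qcnj ((C * mp_inv B) $$ (g, f))) = qcnj (num * inverse d)"
    by (simp add: divide_quat_def)
  then have "(C * mp_inv B) $$ (g, f) = inverse d * qcnj num" by (simp add: inv_real)
  also have "\<dots> = qcnj num * inverse d"
    using inv_real by (intro qreal_commute) (simp add: qreal_def)
  also have "qcnj num = (\<Sum>\<alpha>\<in>{\<alpha> \<in> Lset (qrank B) q. f \<in> \<alpha>}. rdet \<alpha> f (row_repl (B * qadj B) f (row (C * qadj B) g)))"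
    unfolding num_def qcnj_sum
  proof (rule sum.cong[OF refl])
    fix \<alpha> assume "\<alpha> \<in> {\<alpha> \<in> Lset (qrank B) q. f \<in> \<alpha>}"
    then have \<alpha>: "\<alpha> \<subseteq> {..<q}" "f \<in> \<alpha>" using Lset_subset by auto
    let ?R = "row_repl (B * qadj B) f (row (C * qadj B) g)"
    have R: "?R \<in> carrier_mat q q" using B by (simp add: row_repl_def)
    have adjF: "qadj (B * qadj B) = B * qadj B" by (simp add: qadj_mult[OF B B'])
    have adjCB: "B * qadj C = qadj (C * qadj B)" by (simp add: qadj_mult[OF C B'])
    \<comment> \<open>Conjugate transposition turns the replaced row into a replaced column, as
      \<open>B * qadj B\<close> is self-adjoint.\<close>
    have "qadj ?R = col_repl (B * qadj B) f (col (B * qadj C) g)"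
    proof (rule eq_matI)
      fix i j assume "i < dim_row (col_repl (B * qadj B) f (col (B * qadj C) g))"
        "j < dim_col (col_repl (B * qadj B) f (col (B * qadj C) g))"
      then have ij: "i < q" "j < q" using F by (auto simp: col_repl_def)
      have "qcnj ((B * qadj B) $$ (j, i)) = (B * qadj B) $$ (i, j)"
        using index_qadj[of i "B * qadj B" j] ij F unfolding adjF by auto
      moreover have "qcnj (row (C * qadj B) g $ i) = col (qadj (C * qadj B)) g $ i"
        using B C ij gf by (subst index_col) auto
      moreover have "qadj ?R $$ (i, j) = qcnj (?R $$ (j, i))" using R ij by (intro index_qadj) auto
      moreover have "?R $$ (j, i) = (if j = f then row (C * qadj B) g $ i else (B * qadj B) $$ (j, i))"
        unfolding row_repl_def using F ij by (subst index_mat(1)) auto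
      moreover have "col_repl (B * qadj B) f (col (B * qadj C) g) $$ (i, j)
          = (if j = f then col (B * qadj C) g $ i else (B * qadj B) $$ (i, j))"
        unfolding col_repl_def using F ij by (subst index_mat(1)) auto
      ultimately show "qadj ?R $$ (i, j) = col_repl (B * qadj B) f (col (B * qadj C) g) $$ (i, j)"
        unfolding adjCB by simp
    qed (use F R in \<open>auto simp: col_repl_def\<close>)
    then have "qcnj (rdet \<alpha> f ?R) = cdet \<alpha> f (col_repl (B * qadj B) f (col (B * qadj C) g))"
      using qcnj_rdet[OF R \<alpha>] by simp
    then show "qcnj (cdet \<alpha> f (col_repl (B * qadj B) f (col (B * qadj C) g))) = rdet \<alpha> f ?R"
      by (metis qcnj_simps(7))
  qed
  finally show ?thesis by (simp add: d_def divide_quat_def)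
qed

section \<open>Determinantal representations of \<open>X1\<close> and \<open>X2\<close>\<close>

theorem theorem5p2:
  fixes A1 B2 C :: "quat mat" and m n q s r1 r2 :: nat
  assumes A1: "A1 \<in> carrier_mat m n" and rA1: "qrank A1 = r1"
    and B2: "B2 \<in> carrier_mat q s" and rB2: "qrank B2 = r2"
    and C: "C \<in> carrier_mat m s"
  defines "X1 \<equiv> mp_inv A1 * C"
    and "X2 \<equiv> C * mp_inv B2 - A1 * mp_inv A1 * C * mp_inv B2"
    and "C1 \<equiv> qadj A1 * C"
    and "C2 \<equiv> C * qadj B2"
  shows "(\<forall>i < n. \<forall>j < s.
            X1 $$ (i, j) =
              (\<Sum>\<beta>\<in>{\<beta> \<in> Lset r1 n. i \<in> \<beta>}. cdet \<beta> i (col_repl (qadj A1 * A1) i (col C1 j)))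
              / (\<Sum>\<beta>\<in>Lset r1 n. hdet \<beta> (qadj A1 * A1)))
       \<and> (\<forall>g < m. \<forall>f < q.
            X2 $$ (g, f) =
              (\<Sum>\<alpha>\<in>{\<alpha> \<in> Lset r2 q. f \<in> \<alpha>}. rdet \<alpha> f (row_repl (B2 * qadj B2) f (row C2 g)))
              / (\<Sum>\<alpha>\<in>Lset r2 q. hdet \<alpha> (B2 * qadj B2))
            - (\<Sum>l<m.
                 (\<Sum>\<alpha>\<in>{\<alpha> \<in> Lset r1 m. l \<in> \<alpha>}.
                    rdet \<alpha> l (row_repl (A1 * qadj A1) l (row (A1 * qadj A1) g)))
                 * (\<Sum>\<alpha>\<in>{\<alpha> \<in> Lset r2 q. f \<in> \<alpha>}.
                    rdet \<alpha> f (row_repl (B2 * qadj B2) f (row C2 l))))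
              / ((\<Sum>\<alpha>\<in>Lset r1 m. hdet \<alpha> (A1 * qadj A1)) * (\<Sum>\<alpha>\<in>Lset r2 q. hdet \<alpha> (B2 * qadj B2))))"
proof (intro conjI allI impI)
  fix i j assume "i < n" "j < s"
  then show "X1 $$ (i, j) =
              (\<Sum>\<beta>\<in>{\<beta> \<in> Lset r1 n. i \<in> \<beta>}. cdet \<beta> i (col_repl (qadj A1 * A1) i (col C1 j)))
              / (\<Sum>\<beta>\<in>Lset r1 n. hdet \<beta> (qadj A1 * A1))"
    unfolding X1_def C1_def rA1[symmetric] by (rule mp_inv_mult_cdet[OF A1 C])
next
  fix g f assume gf: "g < m" "f < q"
  define a where "a l = (\<Sum>\<alpha>\<in>{\<alpha> \<in> Lset r1 m. l \<in> \<alpha>}.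
      rdet \<alpha> l (row_repl (A1 * qadj A1) l (row (A1 * qadj A1) g)))" for l
  define b where "b l = (\<Sum>\<alpha>\<in>{\<alpha> \<in> Lset r2 q. f \<in> \<alpha>}.
      rdet \<alpha> f (row_repl (B2 * qadj B2) f (row C2 l)))" for l
  define da where "da = (\<Sum>\<alpha>\<in>Lset r1 m. hdet \<alpha> (A1 * qadj A1))"
  define db where "db = (\<Sum>\<alpha>\<in>Lset r2 q. hdet \<alpha> (B2 * qadj B2))"
  have Y: "mp_inv A1 \<in> carrier_mat n m" and Z: "mp_inv B2 \<in> carrier_mat s q"
    using mp_inv_qadj(2)[of A1] mp_inv_qadj(2)[of B2] A1 B2 by simp_all
  have Q: "A1 * mp_inv A1 \<in> carrier_mat m m" and CZ: "C * mp_inv B2 \<in> carrier_mat m q"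
    using A1 Y C Z mult_carrier_mat by blast+
  have "da = pdet_sum (qadj A1) r1"
    using sum_hdet_qadj_mult_self[of "qadj A1" n m r1] A1 by (simp add: da_def)
  then have da: "qreal da" "da \<noteq> 0"
    using pdet_sum_real pdet_sum_rank_nonzero[of "qadj A1"] by (simp_all add: rA1 qrank_qadj)
  have "db = pdet_sum (qadj B2) r2"
    using sum_hdet_qadj_mult_self[of "qadj B2" s q r2] B2 by (simp add: db_def)
  then have db: "qreal db" "db \<noteq> 0"
    using pdet_sum_real pdet_sum_rank_nonzero[of "qadj B2"] by (simp_all add: rB2 qrank_qadj)
  \<comment> \<open>The row formula with \<open>A1\<close> in both roles gives the entries of the
    projection onto the range of \<open>A1\<close>.\<close>
  have q: "(A1 * mp_inv A1) $$ (g, l) = a l / da" if "l < m" for l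
    using mult_mp_inv_rdet[OF A1 A1 gf(1) that] by (simp add: a_def da_def rA1)
  have c: "(C * mp_inv B2) $$ (l, f) = b l / db" if "l < m" for l
    using mult_mp_inv_rdet[OF B2 C that gf(2)] by (simp add: b_def db_def rB2 C2_def)
  have "(A1 * mp_inv A1 * C * mp_inv B2) $$ (g, f) = (\<Sum>l<m. (a l / da) * (b l / db))"
    unfolding assoc_mult_mat[OF Q C Z] index_mult_mat_sum[OF Q CZ gf]
    by (intro sum.cong) (auto simp: q c)
  \<comment> \<open>The quaternionic numerators keep their order, while the real denominators are
    collected on the right.\<close>
  also have "\<dots> = (\<Sum>l<m. a l * b l * inverse (da * db))"
  proof (rule sum.cong[OF refl])
    fix l
    have "(a l / da) * (b l / db) = a l * (inverse da * b l) * inverse db"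
      by (simp add: divide_quat_def mult.assoc)
    also have "inverse da * b l = b l * inverse da"
      by (intro qreal_commute qreal_inverse da(1))
    also have "a l * (b l * inverse da) * inverse db = a l * b l * (inverse da * inverse db)"
      by (simp add: mult.assoc)
    \<comment> \<open>Inversion reverses a product of nonzero factors; for real ones the order is
      immaterial.\<close>
    also have "inverse da * inverse db = inverse (da * db)"
      unfolding qreal_commute[OF da(1)] using da db by (simp add: nonzero_inverse_mult_distrib)
    finally show "(a l / da) * (b l / db) = a l * b l * inverse (da * db)" .
  qed
  also have "\<dots> = (\<Sum>l<m. a l * b l) / (da * db)"
    by (simp add: divide_quat_def sum_distrib_right)
  finally have "X2 $$ (g, f) = b g / db - (\<Sum>l<m. a l * b l) / (da * db)"
    unfolding X2_def using c[OF gf(1)] mult_carrier_mat[OF mult_carrier_mat[OF Q C] Z] CZ gf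
    by (subst index_minus_mat(1)) auto
  then show "X2 $$ (g, f) =
              (\<Sum>\<alpha>\<in>{\<alpha> \<in> Lset r2 q. f \<in> \<alpha>}. rdet \<alpha> f (row_repl (B2 * qadj B2) f (row C2 g)))
              / (\<Sum>\<alpha>\<in>Lset r2 q. hdet \<alpha> (B2 * qadj B2))
            - (\<Sum>l<m.
                 (\<Sum>\<alpha>\<in>{\<alpha> \<in> Lset r1 m. l \<in> \<alpha>}.
                    rdet \<alpha> l (row_repl (A1 * qadj A1) l (row (A1 * qadj A1) g)))
                 * (\<Sum>\<alpha>\<in>{\<alpha> \<in> Lset r2 q. f \<in> \<alpha>}.
                    rdet \<alpha> f (row_repl (B2 * qadj B2) f (row C2 l))))
              / ((\<Sum>\<alpha>\<in>Lset r1 m. hdet \<alpha> (A1 * qadj A1)) * (\<Sum>\<alpha>\<in>Lset r2 q. hdet \<alpha> (B2 * qadj B2)))"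
    by (simp only: a_def b_def da_def db_def)
qed

end
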